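(* Consider the risk-sensitive Bayesian house selling problem with horizon $N\in\mathbb{N}$, $$J_N(x):=\sup_{0\le\tau\le N}\int_\Theta\mathbb{E}_{x\theta}\big[U(X_\tau-c_\theta\tau)\big]Q_0(d\theta),$$ the supremum being over all stopping times $\tau$ with respect to the observed offers, and the reservation levels $x^*_{n,N}(\mu):=U_\mu^{-1}\big(d_{N-n}(\mu)\big)$, $n=0,\ldots,N-1$. a) The optimal stopping time is $$\tau^*=\inf\big\{n\in\mathbb{N}_0:\ X_n\ge x^*_{n,N}(\mu_n(\cdot|h_n))\big\}\wedge N,$$ where $h_n=(X_0,\ldots,X_n)$. b) The reservation levels can recursively be computed by $$x^*_{N-1,N}(\mu_{N-1})=U_{\mu_{N-1}}^{-1}\Big(\int_{\mathbb{R}}\int_{\mathbb{R}}U(x+s)\,\Psi^S(x,\mu_{N-1})(ds)\,Q^X(dx|\mu_{N-1}^\Theta)\Big),$$ $$x^*_{n,N}(\mu_n)=U_{\mu_n}^{-1}\Big(\int_{\mathbb{R}}U_{\Psi(x,\mu_n)}\Big(\max\big\{x,\,x^*_{n+1,N}(\Psi(x,\mu_n))\big\}\Big)Q^X(dx|\mu_n^\Theta)\Big),\qquad n=0,\ldots,N-2.$$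
   Context: Setting. $\Theta$ is a Borel space (Borel subset of a Polish space) and $\theta\in\Theta$ an unknown parameter with prior distribution $Q_0$. Given $\theta$, real-valued offers $X_0,X_1,\ldots,X_N$ are independent and identically distributed with distribution $Q_\theta$, which has a density $q(x|\theta)$ with respect to a $\sigma$-finite measure $\lambda$; $q$ is continuous in both parameters with compact support. $\mathbb{E}_{x\theta}$ denotes expectation given the parameter $\theta$ and $X_0=x$ (so $X_1,\ldots,X_N$ are i.i.d. $\sim Q_\theta$). The observation cost $c_\theta>0$ per rejected offer is continuous in $\theta$, not observed, and bounded: $0<\underline{c}\le c_\theta\le\overline{c}$ for constants $\underline{c}<\overline{c}$. $U:\mathbb{R}\to\mathbb{R}$ is strictly increasing and concave, and $\sup_\theta\mathbb{E}_\theta[X_1^+]<\infty$. If one has not stopped before time $N$, the last offer $X_N$ must be accepted. Notation. $\mathbb{R}_-=(-\infty,0]$. For a probability measure $\mu$ on $\Theta\times\mathbb{R}_-$ whose second component has bounded support, $\mu^\Theta$ and $\mu^S$ are its marginals on $\Theta$ and $\mathbb{R}_-$. The updating operator is $$\Psi(x',\mu)(B_1\times B_2):=\frac{\int_{B_1}\int_{\mathbb{R}_-}q(x'|\theta)\,\delta_{s-c_\theta}(B_2)\,\mu(d\theta,ds)}{\int_\Theta q(x'|\theta)\,\mu^\Theta(d\theta)},\qquad B_1\in\mathcal{B}(\Theta),\ B_2\in\mathcal{B}(\mathbb{R}_-),$$ defined where the denominator is positive, and $\Psi^S(x',\mu)$ is the $\mathbb{R}_-$-marginal of $\Psi(x',\mu)$.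 Moreover $Q^X(B|\mu^\Theta):=\int_B\int_\Theta q(x'|\theta)\,\mu^\Theta(d\theta)\lambda(dx')$ (the points $x'$ where $\Psi$ is undefined form a null set for this measure). The conditional distributions of $(\theta,\text{accumulated negative cost})$ are generated by $\mu_0(\cdot|h_0):=Q_0\otimes\delta_0$, $\mu_{n+1}(\cdot|h_n,x'):=\Psi(x',\mu_n(\cdot|h_n))$, with $h_n=(x_0,\ldots,x_n)$. Define $U_\mu(x):=\int U(x+s)\,\mu^S(ds)$, which is continuous and strictly increasing in $x$, with inverse $U_\mu^{-1}$. Define recursively $V_0(x,\mu):=U_\mu(x)$ and, for $n=1,\ldots,N$, $$d_n(\mu):=\int_{\mathbb{R}}V_{n-1}\big(x',\Psi(x',\mu)\big)\,Q^X(dx'|\mu^\Theta),\qquad V_n(x,\mu):=\max\{U_\mu(x),d_n(\mu)\}.$$ In the definition of $\tau^*$ only $n\le N-1$ matter, and $\inf\emptyset=\infty$. In part b), $\mu_{N-1}$ and $\mu_n$ stand for arbitrary probability measures on $\Theta\times\mathbb{R}_-$ whose second component has bounded support. *)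

theory Defs
  imports "HOL-Probability.Probability"
begin

section \<open>The model\<close>

abbreviation param_space :: "'a::polish_space set \<Rightarrow> 'a measure" where
  "param_space Th \<equiv> restrict_space borel Th"

abbreviation cost_space :: "real measure" where
  "cost_space \<equiv> restrict_space borel {..0}"

abbreviation belief_space :: "'a::polish_space set \<Rightarrow> ('a \<times> real) measure" where
  "belief_space Th \<equiv> param_space Th \<Otimes>\<^sub>M cost_space"

text \<open>The second marginal has bounded support: it is concentrated on a bounded set.\<close>

definition bounded_belief :: "'a::polish_space set \<Rightarrow> ('a \<times> real) measure \<Rightarrow> bool" where
  "bounded_belief Th \<mu> \<longleftrightarrow>
     prob_space \<mu> \<and> sets \<mu> = sets (belief_space Th) \<and> (\<exists>B. bounded B \<and> (AE z in \<mu>. snd z \<in> B))"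

definition marg_param :: "'a::polish_space set \<Rightarrow> ('a \<times> real) measure \<Rightarrow> 'a measure" where
  "marg_param Th \<mu> = distr \<mu> (param_space Th) fst"

definition marg_cost :: "('a \<times> real) measure \<Rightarrow> real measure" where
  "marg_cost \<mu> = distr \<mu> cost_space snd"

definition offer_dist :: "real measure \<Rightarrow> (real \<Rightarrow> 'a \<Rightarrow> real) \<Rightarrow> 'a \<Rightarrow> real measure" where
  "offer_dist lam q \<theta> = density lam (\<lambda>x. ennreal (q x \<theta>))"

definition pred_density :: "(real \<Rightarrow> 'a \<Rightarrow> real) \<Rightarrow> 'a measure \<Rightarrow> real \<Rightarrow> ennreal" where
  "pred_density q \<nu> x' = (\<integral>\<^sup>+ \<theta>. ennreal (q x' \<theta>) \<partial>\<nu>)"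

definition QX :: "real measure \<Rightarrow> (real \<Rightarrow> 'a \<Rightarrow> real) \<Rightarrow> 'a measure \<Rightarrow> real measure" where
  "QX lam q \<nu> = density lam (pred_density q \<nu>)"

text \<open>
  The updating operator, written as the image of the reweighted measure under
  \<open>(\<theta>, s) \<mapsto> (\<theta>, s - c \<theta>)\<close>; its values on rectangles are computed in \<open>Psi_rectangle\<close> below.
  Where the quotient makes no sense, which is a null set for \<open>QX lam q (marg_param Th \<mu>)\<close>, we
  put \<open>Psi x' \<mu> = \<mu>\<close>, so that beliefs remain probability measures.
\<close>

definition Psi :: "'a::polish_space set \<Rightarrow> (real \<Rightarrow> 'a \<Rightarrow> real) \<Rightarrow> ('a \<Rightarrow> real) \<Rightarrow>
    real \<Rightarrow> ('a \<times> real) measure \<Rightarrow> ('a \<times> real) measure" where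
  "Psi Th q c x' \<mu> =
     (let D = pred_density q (marg_param Th \<mu>) x' in
      if 0 < D \<and> D < \<infinity>
      then distr (density \<mu> (\<lambda>(\<theta>, s). ennreal (q x' \<theta>) / D)) (belief_space Th)
             (\<lambda>(\<theta>, s). (\<theta>, s - c \<theta>))
      else \<mu>)"

text \<open>\<open>belief n h\<close> only depends on \<open>h 1, \<dots>, h n\<close>: the initial offer carries no update.\<close>

primrec belief :: "'a::polish_space set \<Rightarrow> (real \<Rightarrow> 'a \<Rightarrow> real) \<Rightarrow> ('a \<Rightarrow> real) \<Rightarrow> 'a measure \<Rightarrow>
    nat \<Rightarrow> (nat \<Rightarrow> real) \<Rightarrow> ('a \<times> real) measure" where
  "belief Th q c Q0 0 h = Q0 \<Otimes>\<^sub>M return cost_space 0"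
| "belief Th q c Q0 (Suc n) h = Psi Th q c (h (Suc n)) (belief Th q c Q0 n h)"


section \<open>Value functions and reservation levels\<close>

definition U_avg :: "(real \<Rightarrow> real) \<Rightarrow> ('a \<times> real) measure \<Rightarrow> real \<Rightarrow> real" where
  "U_avg U \<mu> x = (\<integral>s. U (x + s) \<partial>marg_cost \<mu>)"

definition continuation :: "'a::polish_space set \<Rightarrow> real measure \<Rightarrow> (real \<Rightarrow> 'a \<Rightarrow> real) \<Rightarrow>
    ('a \<Rightarrow> real) \<Rightarrow> (real \<Rightarrow> ('a \<times> real) measure \<Rightarrow> real) \<Rightarrow> ('a \<times> real) measure \<Rightarrow> real" where
  "continuation Th lam q c W \<mu> = (\<integral>x'. W x' (Psi Th q c x' \<mu>) \<partial>QX lam q (marg_param Th \<mu>))"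

primrec Vfun :: "'a::polish_space set \<Rightarrow> real measure \<Rightarrow> (real \<Rightarrow> 'a \<Rightarrow> real) \<Rightarrow> ('a \<Rightarrow> real) \<Rightarrow>
    (real \<Rightarrow> real) \<Rightarrow> nat \<Rightarrow> real \<Rightarrow> ('a \<times> real) measure \<Rightarrow> real" where
  "Vfun Th lam q c U 0 = (\<lambda>x \<mu>. U_avg U \<mu> x)"
| "Vfun Th lam q c U (Suc n) =
     (\<lambda>x \<mu>. max (U_avg U \<mu> x) (continuation Th lam q c (Vfun Th lam q c U n) \<mu>))"

text \<open>Only meaningful for \<open>n \<ge> 1\<close>.\<close>

definition dval :: "'a::polish_space set \<Rightarrow> real measure \<Rightarrow> (real \<Rightarrow> 'a \<Rightarrow> real) \<Rightarrow> ('a \<Rightarrow> real) \<Rightarrow>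
    (real \<Rightarrow> real) \<Rightarrow> nat \<Rightarrow> ('a \<times> real) measure \<Rightarrow> real" where
  "dval Th lam q c U n \<mu> = continuation Th lam q c (Vfun Th lam q c U (n - 1)) \<mu>"

definition xstar :: "'a::polish_space set \<Rightarrow> real measure \<Rightarrow> (real \<Rightarrow> 'a \<Rightarrow> real) \<Rightarrow>
    ('a \<Rightarrow> real) \<Rightarrow> (real \<Rightarrow> real) \<Rightarrow> nat \<Rightarrow> nat \<Rightarrow> ('a \<times> real) measure \<Rightarrow> real" where
  "xstar Th lam q c U N n \<mu> = inv (U_avg U \<mu>) (dval Th lam q c U (N - n) \<mu>)"


section \<open>The stopping problem\<close>

text \<open>
  Canonical construction: a path \<open>\<omega>\<close> lists the offers \<open>X\<^sub>0, \<dots>, X\<^sub>N\<close>. The law below is the one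
  behind the expectation given the parameter \<open>\<theta>\<close> and \<open>X\<^sub>0 = x\<close>.
\<close>

abbreviation path_space :: "nat \<Rightarrow> (nat \<Rightarrow> real) measure" where
  "path_space N \<equiv> PiM {..N} (\<lambda>_. borel)"

definition offer_law :: "real measure \<Rightarrow> (real \<Rightarrow> 'a \<Rightarrow> real) \<Rightarrow> nat \<Rightarrow> real \<Rightarrow> 'a \<Rightarrow>
    (nat \<Rightarrow> real) measure" where
  "offer_law lam q N x \<theta> =
     PiM {..N} (\<lambda>i. if i = 0 then return borel x else offer_dist lam q \<theta>)"

text \<open>\<open>offer_filtration N n\<close> is the sigma-algebra generated by \<open>X\<^sub>0, \<dots>, X\<^sub>n\<close>.\<close>

definition offer_filtration :: "nat \<Rightarrow> nat \<Rightarrow> (nat \<Rightarrow> real) measure" where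
  "offer_filtration N n =
     vimage_algebra (space (path_space N)) (\<lambda>\<omega>. restrict \<omega> {..n}) (path_space n)"

definition admissible :: "nat \<Rightarrow> ((nat \<Rightarrow> real) \<Rightarrow> nat) set" where
  "admissible N = {\<tau>. stopping_time (offer_filtration N) \<tau> \<and> (\<forall>\<omega> \<in> space (path_space N). \<tau> \<omega> \<le> N)}"

definition reward :: "real measure \<Rightarrow> (real \<Rightarrow> 'a \<Rightarrow> real) \<Rightarrow> ('a \<Rightarrow> real) \<Rightarrow> (real \<Rightarrow> real) \<Rightarrow>
    'a measure \<Rightarrow> nat \<Rightarrow> real \<Rightarrow> ((nat \<Rightarrow> real) \<Rightarrow> nat) \<Rightarrow> real" where
  "reward lam q c U Q0 N x \<tau> =
     (\<integral>\<theta>. (\<integral>\<omega>. U (\<omega> (\<tau> \<omega>) - c \<theta> * real (\<tau> \<omega>)) \<partial>offer_law lam q N x \<theta>) \<partial>Q0)"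

text \<open>The supremum is taken in the extended reals, so that no boundedness is presupposed.\<close>

definition Jval :: "real measure \<Rightarrow> (real \<Rightarrow> 'a \<Rightarrow> real) \<Rightarrow> ('a \<Rightarrow> real) \<Rightarrow> (real \<Rightarrow> real) \<Rightarrow>
    'a measure \<Rightarrow> nat \<Rightarrow> real \<Rightarrow> ereal" where
  "Jval lam q c U Q0 N x = (SUP \<tau> \<in> admissible N. ereal (reward lam q c U Q0 N x \<tau>))"

text \<open>Inserting \<open>N\<close> caps the infimum at \<open>N\<close> and covers the convention \<open>inf {} = \<infinity>\<close>.\<close>

definition tau_star :: "'a::polish_space set \<Rightarrow> real measure \<Rightarrow> (real \<Rightarrow> 'a \<Rightarrow> real) \<Rightarrow>
    ('a \<Rightarrow> real) \<Rightarrow> (real \<Rightarrow> real) \<Rightarrow> 'a measure \<Rightarrow> nat \<Rightarrow> (nat \<Rightarrow> real) \<Rightarrow> nat" where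
  "tau_star Th lam q c U Q0 N \<omega> =
     Inf (insert N {n. n < N \<and> \<omega> n \<ge> xstar Th lam q c U N n (belief Th q c Q0 n \<omega>)})"


section \<open>The updating operator on rectangles\<close>

lemma Psi_rectangle:
  fixes Th :: "'a::polish_space set"
  assumes sets_\<mu>: "sets \<mu> = sets (belief_space Th)"
    and q: "(\<lambda>\<theta>. q x' \<theta>) \<in> borel_measurable (param_space Th)"
    and c: "c \<in> borel_measurable (param_space Th)" "\<And>\<theta>. \<theta> \<in> Th \<Longrightarrow> 0 \<le> c \<theta>"
    and D: "0 < pred_density q (marg_param Th \<mu>) x'" "pred_density q (marg_param Th \<mu>) x' < \<infinity>"
    and B: "B1 \<in> sets (param_space Th)" "B2 \<in> sets cost_space"
  shows "emeasure (Psi Th q c x' \<mu>) (B1 \<times> B2) =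
    (\<integral>\<^sup>+ (\<theta>, s). indicator B1 \<theta> * ennreal (q x' \<theta>) * emeasure (return borel (s - c \<theta>)) B2 \<partial>\<mu>) /
    (\<integral>\<^sup>+ \<theta>. ennreal (q x' \<theta>) \<partial>marg_param Th \<mu>)"
proof -
  define D where "D = pred_density q (marg_param Th \<mu>) x'"
  note [measurable_cong] = sets_\<mu>
  note [measurable] = q c(1) B
  have sp: "space \<mu> = Th \<times> {..0}"
    using sets_eq_imp_space_eq[OF sets_\<mu>] by (simp add: space_pair_measure space_restrict_space)
  have "(\<lambda>z. snd z - c (fst z)) \<in> \<mu> \<rightarrow>\<^sub>M cost_space"
  proof (rule measurable_restrict_space2)
    show "(\<lambda>z. snd z - c (fst z)) \<in> space \<mu> \<rightarrow> {..0}"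
      using c(2) sp by (force intro: order_trans)
    have "snd \<in> \<mu> \<rightarrow>\<^sub>M cost_space" by measurable
    then have [measurable]: "snd \<in> borel_measurable \<mu>"
      by (rule measurable_restrict_space2_iff[THEN iffD1, THEN conjunct1])
    show "(\<lambda>z. snd z - c (fst z)) \<in> borel_measurable \<mu>" by measurable
  qed
  then have [measurable]: "(\<lambda>(\<theta>, s). (\<theta>, s - c \<theta>)) \<in> \<mu> \<rightarrow>\<^sub>M belief_space Th"
    unfolding split_beta' by (intro measurable_Pair) simp_all
  have B2: "B2 \<in> sets borel"
    using B(2) by (simp add: sets_restrict_space_iff)
  have B1B2: "B1 \<times> B2 \<in> sets (belief_space Th)" using B by auto
  have pre: "(\<lambda>(\<theta>, s). (\<theta>, s - c \<theta>)) -` (B1 \<times> B2) \<inter> space \<mu> \<in> sets \<mu>"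
    using B1B2 by (rule measurable_sets[rotated]) measurable
  have "emeasure (Psi Th q c x' \<mu>) (B1 \<times> B2) =
    emeasure (density \<mu> (\<lambda>(\<theta>, s). ennreal (q x' \<theta>) / D))
      ((\<lambda>(\<theta>, s). (\<theta>, s - c \<theta>)) -` (B1 \<times> B2) \<inter> space \<mu>)"
    using D B1B2 by (simp add: Psi_def D_def Let_def emeasure_distr)
  also have "\<dots> = (\<integral>\<^sup>+ z. (ennreal (q x' (fst z)) / D) *
      indicator ((\<lambda>(\<theta>, s). (\<theta>, s - c \<theta>)) -` (B1 \<times> B2) \<inter> space \<mu>) z \<partial>\<mu>)"
    using pre by (subst emeasure_density) (auto simp: split_beta')
  also have "\<dots> = (\<integral>\<^sup>+ z. (indicator B1 (fst z) * ennreal (q x' (fst z)) *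
      emeasure (return borel (snd z - c (fst z))) B2) / D \<partial>\<mu>)"
    using B2 by (intro nn_integral_cong) (auto simp: indicator_def)
  also have "\<dots> = (\<integral>\<^sup>+ z. indicator B1 (fst z) * ennreal (q x' (fst z)) *
      emeasure (return borel (snd z - c (fst z))) B2 \<partial>\<mu>) / D"
  proof (rule nn_integral_divide)
    have "(\<lambda>z. indicator (B1 \<times> B2) (case z of (\<theta>, s) \<Rightarrow> (\<theta>, s - c \<theta>)) * ennreal (q x' (fst z)))
      \<in> borel_measurable \<mu>" using B1B2 by measurable
    also have "?this \<longleftrightarrow> (\<lambda>z. indicator B1 (fst z) * ennreal (q x' (fst z)) *
      emeasure (return borel (snd z - c (fst z))) B2) \<in> borel_measurable \<mu>"
      using B2 by (intro measurable_cong) (auto simp: indicator_def split_beta')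
    finally show "(\<lambda>z. indicator B1 (fst z) * ennreal (q x' (fst z)) *
      emeasure (return borel (snd z - c (fst z))) B2) \<in> borel_measurable \<mu>" .
  qed
  finally show ?thesis
    by (simp add: D_def pred_density_def split_beta')
qed

end

theory Submission
  imports Defs
begin

text \<open>Offers are bounded and waiting only costs, so the utility is bounded above by some \<open>U b\<close>: the
  losses \<open>U b - U y\<close> are nonnegative, and the dynamic programming recursion can be run with
  nonnegative integrals, for which measurability and Fubini need no integrability. One step of the
  recursion is Bayes' rule: the expectation over the parameter and the next offer equals the
  expectation over the predictive law of the next offer and then over the updated belief. Backward
  induction along the observed offers bounds the loss of every stopping rule below by the value
  recursion, with equality for the rule that stops as soon as the stopping loss does not exceed the
  continuation loss. This is the reservation level rule, since \<open>U_avg U \<mu>\<close> is continuous, strictly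
  increasing and unbounded below, so that it attains the continuation value.\<close>

subsection \<open>Beliefs and Bayes' rule\<close>

text \<open>Two features of the formal integrals shape the proof: a Bochner integral is 0 where
  integrability fails, and \<open>ennreal\<close> truncates negative differences. So every passage
  between values and losses carries an upper bound by \<open>U b\<close> and a finiteness bound; the
  latter comes from the worst case of lowest offer \<open>-M\<close>, cost \<open>cu\<close> per
  period and bounded support of the belief. The level \<open>b\<close> stays variable because the
  initial offer \<open>x\<close> may exceed \<open>M\<close>; in the end \<open>b = max x M\<close>.
  No abstract conditional expectation is formed: on the canonical path space the conditional loss of
  a rule is an iterated integral over the remaining offers, defined at every history, so optimality
  becomes an inequality at each single history. The default \<open>Psi x \<mu> = \<mu>\<close>
  serves this by keeping beliefs bounded at all offers instead of almost all. Measurability of the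
  stopping events is read off from losses, since reservation levels are inverses of functions that
  vary with the belief.\<close>

lemma space_belief_space: "space (belief_space Th) = Th \<times> {..0}"
  by (simp add: space_pair_measure space_restrict_space)

lemma snd_belief_measurable [measurable]: "snd \<in> borel_measurable (belief_space Th)"
proof -
  have "snd \<in> belief_space Th \<rightarrow>\<^sub>M cost_space" by measurable
  then show ?thesis
    by (rule measurable_restrict_space2_iff[THEN iffD1, THEN conjunct1])
qed

text \<open>The way back from losses to Bochner integrals: finiteness of \<open>I\<close> yields
  integrability of \<open>f\<close>, and the bound by \<open>C\<close> keeps \<open>ennreal\<close>
  from truncating. It is applied to \<open>U_avg\<close>, to \<open>continuation\<close> and to both
  integrals in \<open>reward\<close>.\<close>

lemma (in prob_space) integral_eq_const_minus_nn_integral: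
  fixes f :: "'a \<Rightarrow> real"
  assumes [measurable]: "f \<in> borel_measurable M" and le: "AE x in M. f x \<le> C"
    and I: "(\<integral>\<^sup>+x. ennreal (C - f x) \<partial>M) = I" "I < \<infinity>"
  shows "integrable M f" "integral\<^sup>L M f \<le> C" "ennreal (C - integral\<^sup>L M f) = I"
proof -
  have *: "integrable M (\<lambda>x. C - f x)"
    using le I by (intro integrableI_nonneg) auto
  have "(\<lambda>x. C - (C - f x)) = f" by simp
  then show int: "integrable M f"
    using Bochner_Integration.integrable_diff[OF integrable_const[of C] *] by (simp only:)
  then show "integral\<^sup>L M f \<le> C"
    using integral_mono_AE[OF int _ le] by (simp add: prob_space)
  have "integral\<^sup>L M (\<lambda>x. C - f x) = C - integral\<^sup>L M f"
    using int by (simp add: prob_space)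
  then show "ennreal (C - integral\<^sup>L M f) = I"
    using nn_integral_eq_integral[OF *] le I by simp
qed

text \<open>\<open>M\<close> stems from the compact set containing all offers: bounding them above
  makes utility differences nonnegative, bounding them below makes losses finite. \<open>cu\<close>
  bounds the drop of the cost component in one update.\<close>

locale house_selling =
  fixes Th :: "'a::polish_space set" and lam :: "real measure"
    and q :: "real \<Rightarrow> 'a \<Rightarrow> real" and c :: "'a \<Rightarrow> real" and U :: "real \<Rightarrow> real"
    and M cu :: real
  assumes sigma_finite_lam: "sigma_finite_measure lam"
    and sets_lam [measurable_cong]: "sets lam = sets borel"
    and q_nonneg: "\<And>x \<theta>. \<theta> \<in> Th \<Longrightarrow> 0 \<le> q x \<theta>"
    and prob_space_offer_dist: "\<And>\<theta>. \<theta> \<in> Th \<Longrightarrow> prob_space (offer_dist lam q \<theta>)"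
    and q_cont: "continuous_on (UNIV \<times> Th) (\<lambda>(x, \<theta>). q x \<theta>)"
    and q_support: "\<And>x \<theta>. \<theta> \<in> Th \<Longrightarrow> q x \<theta> \<noteq> 0 \<Longrightarrow> \<bar>x\<bar> \<le> M"
    and c_cont: "continuous_on Th c"
    and c_bounds: "\<And>\<theta>. \<theta> \<in> Th \<Longrightarrow> 0 \<le> c \<theta> \<and> c \<theta> \<le> cu"
    and U_strict_mono: "strict_mono U"
    and U_concave: "concave_on UNIV U"
begin

sublocale lam: sigma_finite_measure lam by (rule sigma_finite_lam)

lemma space_lam [simp]: "space lam = UNIV"
  using sets_eq_imp_space_eq[OF sets_lam] by simp

lemma U_mono: "x \<le> y \<Longrightarrow> U x \<le> U y"
  using U_strict_mono by (simp add: strict_mono_less_eq)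

lemma U_measurable [measurable]: "U \<in> borel_measurable borel"
  by (intro borel_measurable_mono monoI U_mono)

lemma c_measurable [measurable]: "c \<in> borel_measurable (param_space Th)"
  by (rule borel_measurable_continuous_on_restrict[OF c_cont])

text \<open>Joint continuity gives joint measurability because the Borel sigma-algebra of the
  product is the product of the Borel sigma-algebras.\<close>

lemma q_measurable [measurable (raw)]:
  assumes [measurable]: "f \<in> borel_measurable N" "g \<in> N \<rightarrow>\<^sub>M param_space Th"
  shows "(\<lambda>w. q (f w) (g w)) \<in> borel_measurable N"
proof -
  have *: "(\<lambda>(x, \<theta>). q x \<theta>) \<in> borel_measurable (restrict_space borel (UNIV \<times> Th))"
    by (rule borel_measurable_continuous_on_restrict[OF q_cont])
  have "g \<in> borel_measurable N \<and> g \<in> space N \<rightarrow> Th"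
    using assms(2) measurable_restrict_space2_iff[of g N borel Th] by auto
  then have "(\<lambda>w. (f w, g w)) \<in> N \<rightarrow>\<^sub>M restrict_space borel (UNIV \<times> Th)"
    by (intro measurable_restrict_space2) (auto simp: borel_prod[symmetric])
  from measurable_compose[OF this *] show ?thesis by simp
qed

lemma q_measurable_offer [measurable]: "\<theta> \<in> Th \<Longrightarrow> (\<lambda>x. q x \<theta>) \<in> borel_measurable lam"
  by (rule q_measurable) (auto simp: space_restrict_space measurable_ident_sets[OF sets_lam])

lemma nn_integral_offer_dist:
  assumes \<theta>: "\<theta> \<in> Th" and [measurable]: "f \<in> borel_measurable borel"
  shows "(\<integral>\<^sup>+x. f x \<partial>offer_dist lam q \<theta>) = (\<integral>\<^sup>+x. ennreal (q x \<theta>) * f x \<partial>lam)"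
  unfolding offer_dist_def using \<theta> by (intro nn_integral_density) auto

lemma nn_integral_q:
  assumes \<theta>: "\<theta> \<in> Th"
  shows "(\<integral>\<^sup>+x. ennreal (q x \<theta>) \<partial>lam) = 1"
  using nn_integral_offer_dist[OF \<theta>, of "\<lambda>_. 1"]
    prob_space.emeasure_space_1[OF prob_space_offer_dist[OF \<theta>]] by simp

text \<open>Beliefs become points of a measurable space, so that integrals against a varying belief,
  and with them the recursion, are measurable in the belief.\<close>

abbreviation "beliefs \<equiv> subprob_algebra (belief_space Th)"

text \<open>The predictive density, integrated over the joint belief so that no marginal has to be
  formed; \<open>pred_density_eq\<close> is the link to the marginal.\<close>

definition pred :: "('a \<times> real) measure \<Rightarrow> real \<Rightarrow> ennreal" where
  "pred \<mu> x = (\<integral>\<^sup>+z. ennreal (q x (fst z)) \<partial>\<mu>)"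

definition shift :: "'a \<times> real \<Rightarrow> 'a \<times> real" where
  "shift z = (fst z, snd z - c (fst z))"

lemma shift_measurable [measurable]: "shift \<in> belief_space Th \<rightarrow>\<^sub>M belief_space Th"
  unfolding shift_def
proof (intro measurable_Pair)
  have "(\<lambda>z. snd z - c (fst z)) \<in> borel_measurable (belief_space Th)" by measurable
  moreover have "(\<lambda>z. snd z - c (fst z)) \<in> space (belief_space Th) \<rightarrow> {..0}"
    using c_bounds by (fastforce simp: space_belief_space)
  ultimately show "(\<lambda>z. snd z - c (fst z)) \<in> belief_space Th \<rightarrow>\<^sub>M cost_space"
    by (intro measurable_restrict_space2)
qed simp

lemma pred_density_eq:
  assumes [measurable_cong]: "sets \<mu> = sets (belief_space Th)"
  shows "pred_density q (marg_param Th \<mu>) x = pred \<mu> x"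
  unfolding pred_density_def marg_param_def pred_def by (rule nn_integral_distr) measurable

lemma pred_measurable [measurable (raw)]:
  assumes [measurable]: "f \<in> borel_measurable N" "g \<in> N \<rightarrow>\<^sub>M beliefs"
  shows "(\<lambda>w. pred (g w) (f w)) \<in> borel_measurable N"
  unfolding pred_def
  by (rule nn_integral_measurable_subprob_algebra2[where N = "belief_space Th"]) measurable

lemma Psi_eq:
  assumes "sets \<mu> = sets (belief_space Th)"
  shows "Psi Th q c x \<mu> = (if 0 < pred \<mu> x \<and> pred \<mu> x < \<infinity>
    then distr (density \<mu> (\<lambda>z. ennreal (q x (fst z)) / pred \<mu> x)) (belief_space Th) shift else \<mu>)"
  using assms by (simp add: Psi_def Let_def pred_density_eq split_beta' shift_def[abs_def])

lemma sets_Psi: "sets \<mu> = sets (belief_space Th) \<Longrightarrow> sets (Psi Th q c x \<mu>) = sets (belief_space Th)"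
  by (simp add: Psi_eq)

lemma nn_integral_Psi:
  assumes \<mu> [measurable_cong]: "sets \<mu> = sets (belief_space Th)"
    and D: "0 < pred \<mu> x" "pred \<mu> x < \<infinity>"
    and [measurable]: "f \<in> borel_measurable (belief_space Th)"
  shows "(\<integral>\<^sup>+z. f z \<partial>Psi Th q c x \<mu>) = (\<integral>\<^sup>+z. ennreal (q x (fst z)) * f (shift z) \<partial>\<mu>) / pred \<mu> x"
proof -
  have "(\<integral>\<^sup>+z. f z \<partial>Psi Th q c x \<mu>) = (\<integral>\<^sup>+z. (ennreal (q x (fst z)) / pred \<mu> x) * f (shift z) \<partial>\<mu>)"
    using D \<mu> by (simp add: Psi_eq nn_integral_distr nn_integral_density)
  also have "\<dots> = (\<integral>\<^sup>+z. (ennreal (q x (fst z)) * f (shift z)) / pred \<mu> x \<partial>\<mu>)"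
    by (simp add: divide_ennreal_def mult_ac)
  also have "\<dots> = (\<integral>\<^sup>+z. ennreal (q x (fst z)) * f (shift z) \<partial>\<mu>) / pred \<mu> x"
    by (rule nn_integral_divide) measurable
  finally show ?thesis .
qed

lemma Psi_prob_space:
  assumes \<mu>: "sets \<mu> = sets (belief_space Th)" "0 < pred \<mu> x" "pred \<mu> x < \<infinity>"
  shows "prob_space (Psi Th q c x \<mu>)"
proof
  have "emeasure (Psi Th q c x \<mu>) (space (Psi Th q c x \<mu>)) = (\<integral>\<^sup>+z. 1 \<partial>Psi Th q c x \<mu>)" by simp
  also have "\<dots> = pred \<mu> x / pred \<mu> x"
    using \<mu> by (subst nn_integral_Psi) (auto simp: pred_def)
  also have "\<dots> = 1" using \<mu> by (auto intro!: ennreal_divide_self)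
  finally show "emeasure (Psi Th q c x \<mu>) (space (Psi Th q c x \<mu>)) = 1" .
qed

lemma beliefsD:
  assumes "\<mu> \<in> space beliefs"
  shows "sets \<mu> = sets (belief_space Th)" "subprob_space \<mu>" "space \<mu> = Th \<times> {..0}"
  using assms sets_eq_imp_space_eq[of \<mu> "belief_space Th"]
  by (auto simp: space_subprob_algebra space_belief_space)

lemma Psi_beliefs: "\<mu> \<in> space beliefs \<Longrightarrow> Psi Th q c x \<mu> \<in> space beliefs"
  using Psi_prob_space[of \<mu> x] Psi_eq[of \<mu> x]
  by (auto simp: space_subprob_algebra sets_Psi prob_space_imp_subprob_space)

text \<open>Measurability into \<open>beliefs\<close> is tested by evaluating at a set: where Bayes'
  formula applies this is a quotient of measurable functions, elsewhere the evaluation of the old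
  belief.\<close>

lemma Psi_measurable [measurable (raw)]:
  assumes f [measurable]: "f \<in> borel_measurable N" and g [measurable]: "g \<in> N \<rightarrow>\<^sub>M beliefs"
  shows "(\<lambda>w. Psi Th q c (f w) (g w)) \<in> N \<rightarrow>\<^sub>M beliefs"
proof (rule measurable_subprob_algebra)
  have g': "g w \<in> space beliefs" if "w \<in> space N" for w
    using measurable_space[OF g that] .
  show "subprob_space (Psi Th q c (f w) (g w))" if "w \<in> space N" for w
    using Psi_beliefs[OF g'[OF that]] by (auto simp: space_subprob_algebra)
  show "sets (Psi Th q c (f w) (g w)) = sets (belief_space Th)" if "w \<in> space N" for w
    using Psi_beliefs[OF g'[OF that]] by (auto simp: space_subprob_algebra)
  fix A assume A [measurable]: "A \<in> sets (belief_space Th)"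
  let ?D = "\<lambda>w. pred (g w) (f w)"
  have [measurable]: "(\<lambda>w. \<integral>\<^sup>+z. ennreal (q (f w) (fst z)) * indicator A (shift z) \<partial>g w) \<in> borel_measurable N"
    by (rule nn_integral_measurable_subprob_algebra2[where N = "belief_space Th"]) measurable
  have "(\<lambda>w. if 0 < ?D w \<and> ?D w < \<infinity> then
      (\<integral>\<^sup>+z. ennreal (q (f w) (fst z)) * indicator A (shift z) \<partial>g w) / ?D w else emeasure (g w) A)
      \<in> borel_measurable N"
    by measurable
  also have "?this \<longleftrightarrow> (\<lambda>w. emeasure (Psi Th q c (f w) (g w)) A) \<in> borel_measurable N"
  proof (intro measurable_cong)
    fix w assume w: "w \<in> space N"
    note s = beliefsD(1)[OF g'[OF w]]
    show "(if 0 < ?D w \<and> ?D w < \<infinity> then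
      (\<integral>\<^sup>+z. ennreal (q (f w) (fst z)) * indicator A (shift z) \<partial>g w) / ?D w else emeasure (g w) A)
      = emeasure (Psi Th q c (f w) (g w)) A"
    proof (cases "0 < ?D w \<and> ?D w < \<infinity>")
      case True
      then show ?thesis
        using nn_integral_Psi[OF s, of "f w" "indicator A"] A s
        by (simp add: nn_integral_indicator[of A] sets_Psi)
    next
      case False
      then show ?thesis using Psi_eq[OF s] by auto
    qed
  qed
  finally show "(\<lambda>w. emeasure (Psi Th q c (f w) (g w)) A) \<in> borel_measurable N" .
qed

text \<open>Bayes' rule for one offer: drawing the parameter first and then the offer yields the same
  joint law as drawing the offer from its predictive law and then updating the belief.\<close>

lemma nn_integral_Bayes:
  assumes prob: "prob_space \<mu>" and \<mu> [measurable_cong]: "sets \<mu> = sets (belief_space Th)"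
    and G [measurable]: "(\<lambda>(x, z). G x z) \<in> borel_measurable (borel \<Otimes>\<^sub>M belief_space Th)"
  shows "(\<integral>\<^sup>+z. (\<integral>\<^sup>+x. ennreal (q x (fst z)) * G x (shift z) \<partial>lam) \<partial>\<mu>)
    = (\<integral>\<^sup>+x. pred \<mu> x * (\<integral>\<^sup>+z. G x z \<partial>Psi Th q c x \<mu>) \<partial>lam)"
    and "(\<integral>\<^sup>+x. pred \<mu> x \<partial>lam) = 1"
proof -
  interpret mu: prob_space \<mu> by fact
  interpret P: pair_sigma_finite lam \<mu> ..
  have sp: "space \<mu> = Th \<times> {..0}"
    using sets_eq_imp_space_eq[OF \<mu>] by (simp add: space_belief_space)
  have [measurable]: "\<mu> \<in> space beliefs"
    by (simp add: space_subprob_algebra \<mu> mu.subprob_space_axioms)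
  have "(\<integral>\<^sup>+x. pred \<mu> x \<partial>lam) = (\<integral>\<^sup>+z. (\<integral>\<^sup>+x. ennreal (q x (fst z)) \<partial>lam) \<partial>\<mu>)"
    unfolding pred_def by (rule P.Fubini'[symmetric]) measurable
  also have "\<dots> = (\<integral>\<^sup>+z. 1 \<partial>\<mu>)"
    using sp by (intro nn_integral_cong nn_integral_q) auto
  finally show 1: "(\<integral>\<^sup>+x. pred \<mu> x \<partial>lam) = 1" by (simp add: mu.emeasure_space_1)
  \<comment> \<open>Total mass 1 excludes an infinite density almost everywhere, so the default of
    \<open>Psi\<close> is met only where \<open>pred \<mu> x = 0\<close>, and there both sides
    vanish.\<close>
  have "AE x in lam. pred \<mu> x \<noteq> \<infinity>"
    using 1 by (intro nn_integral_PInf_AE) auto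
  moreover have "(\<integral>\<^sup>+z. ennreal (q x (fst z)) * G x (shift z) \<partial>\<mu>) =
      pred \<mu> x * (\<integral>\<^sup>+z. G x z \<partial>Psi Th q c x \<mu>)" if fin: "pred \<mu> x \<noteq> \<infinity>" for x
  proof (cases "pred \<mu> x = 0")
    case True
    then have "AE z in \<mu>. ennreal (q x (fst z)) = 0"
      unfolding pred_def by (subst (asm) nn_integral_0_iff_AE) auto
    then have "(\<integral>\<^sup>+z. ennreal (q x (fst z)) * G x (shift z) \<partial>\<mu>) = (\<integral>\<^sup>+z. 0 \<partial>\<mu>)"
      by (intro nn_integral_cong_AE) auto
    with True show ?thesis by simp
  next
    case False
    then show ?thesis
      using fin \<mu> ennreal_mult_divide_eq[of "pred \<mu> x" "\<integral>\<^sup>+z. ennreal (q x (fst z)) * G x (shift z) \<partial>\<mu>"]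
      by (subst nn_integral_Psi)
        (auto simp: ennreal_times_divide mult.commute[of "pred \<mu> x"] less_top zero_less_iff_neq_zero)
  qed
  ultimately have "(\<integral>\<^sup>+x. (\<integral>\<^sup>+z. ennreal (q x (fst z)) * G x (shift z) \<partial>\<mu>) \<partial>lam)
    = (\<integral>\<^sup>+x. pred \<mu> x * (\<integral>\<^sup>+z. G x z \<partial>Psi Th q c x \<mu>) \<partial>lam)"
    by (intro nn_integral_cong_AE) auto
  moreover have "(\<integral>\<^sup>+z. (\<integral>\<^sup>+x. ennreal (q x (fst z)) * G x (shift z) \<partial>lam) \<partial>\<mu>)
    = (\<integral>\<^sup>+x. (\<integral>\<^sup>+z. ennreal (q x (fst z)) * G x (shift z) \<partial>\<mu>) \<partial>lam)"
    by (rule P.Fubini') measurable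
  ultimately show "(\<integral>\<^sup>+z. (\<integral>\<^sup>+x. ennreal (q x (fst z)) * G x (shift z) \<partial>lam) \<partial>\<mu>)
    = (\<integral>\<^sup>+x. pred \<mu> x * (\<integral>\<^sup>+z. G x z \<partial>Psi Th q c x \<mu>) \<partial>lam)" by simp
qed

lemma QX_eq: "sets \<mu> = sets (belief_space Th) \<Longrightarrow> QX lam q (marg_param Th \<mu>) = density lam (pred \<mu>)"
  unfolding QX_def by (intro arg_cong[where f = "density lam"] ext pred_density_eq)

lemma nn_integral_QX:
  assumes \<mu>: "\<mu> \<in> space beliefs" and [measurable]: "f \<in> borel_measurable borel"
  shows "(\<integral>\<^sup>+x. f x \<partial>QX lam q (marg_param Th \<mu>)) = (\<integral>\<^sup>+x. pred \<mu> x * f x \<partial>lam)"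
  using \<mu> by (simp add: QX_eq[OF beliefsD(1)[OF \<mu>]] nn_integral_density)

subsection \<open>Value functions and reservation levels\<close>

text \<open>The truncation by \<open>ennreal\<close> is harmless for \<open>y \<le> b\<close>. The
  level \<open>b\<close> is a parameter since the initial offer may exceed \<open>M\<close>.\<close>

definition loss :: "real \<Rightarrow> real \<Rightarrow> ennreal" where
  "loss b y = ennreal (U b - U y)"

definition stop_loss :: "real \<Rightarrow> real \<Rightarrow> ('a \<times> real) measure \<Rightarrow> ennreal" where
  "stop_loss b x \<mu> = (\<integral>\<^sup>+z. loss b (x + snd z) \<partial>\<mu>)"

definition next_loss :: "(real \<Rightarrow> ('a \<times> real) measure \<Rightarrow> ennreal) \<Rightarrow> ('a \<times> real) measure \<Rightarrow> ennreal" where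
  "next_loss W \<mu> = (\<integral>\<^sup>+x. pred \<mu> x * W x (Psi Th q c x \<mu>) \<partial>lam)"

text \<open>Counterpart of \<open>Vfun\<close>: passing from values to shortfalls exchanges maximum
  and minimum. \<open>V_loss\<close> states the correspondence.\<close>

primrec opt_loss :: "real \<Rightarrow> nat \<Rightarrow> real \<Rightarrow> ('a \<times> real) measure \<Rightarrow> ennreal" where
  "opt_loss b 0 = stop_loss b"
| "opt_loss b (Suc k) = (\<lambda>x \<mu>. min (stop_loss b x \<mu>) (next_loss (opt_loss b k) \<mu>))"

lemma loss_antimono: "x \<le> y \<Longrightarrow> loss b y \<le> loss b x"
  unfolding loss_def by (intro ennreal_leI) (simp add: U_mono)

lemma loss_measurable [measurable]: "loss b \<in> borel_measurable borel"
  unfolding loss_def by measurable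

lemma stop_loss_measurable [measurable (raw)]:
  assumes [measurable]: "f \<in> borel_measurable N" "g \<in> N \<rightarrow>\<^sub>M beliefs"
  shows "(\<lambda>w. stop_loss b (f w) (g w)) \<in> borel_measurable N"
  unfolding stop_loss_def
  by (rule nn_integral_measurable_subprob_algebra2[where N = "belief_space Th"]) measurable

lemma next_loss_measurable:
  assumes W: "(\<lambda>w. W (fst w) (snd w)) \<in> borel_measurable (borel \<Otimes>\<^sub>M beliefs)"
    and g [measurable]: "g \<in> N \<rightarrow>\<^sub>M beliefs"
  shows "(\<lambda>w. next_loss W (g w)) \<in> borel_measurable N"
proof -
  have "(\<lambda>(w, x). (x, Psi Th q c x (g w))) \<in> N \<Otimes>\<^sub>M lam \<rightarrow>\<^sub>M borel \<Otimes>\<^sub>M beliefs"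
    by measurable
  from measurable_compose[OF this W]
  have [measurable]: "(\<lambda>w. W (snd w) (Psi Th q c (snd w) (g (fst w)))) \<in> borel_measurable (N \<Otimes>\<^sub>M lam)"
    by (simp add: split_beta')
  show ?thesis unfolding next_loss_def by measurable
qed

lemma opt_loss_measurable_pair:
  "(\<lambda>w. opt_loss b k (fst w) (snd w)) \<in> borel_measurable (borel \<Otimes>\<^sub>M beliefs)"
proof (induction k)
  case (Suc k)
  have [measurable]: "(\<lambda>w. next_loss (opt_loss b k) (snd w)) \<in> borel_measurable (borel \<Otimes>\<^sub>M beliefs)"
    using Suc by (rule next_loss_measurable) measurable
  show ?case by simp
qed simp

lemmas next_opt_loss_measurable [measurable (raw)] = next_loss_measurable[OF opt_loss_measurable_pair]

lemma opt_loss_measurable [measurable (raw)]: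
  assumes [measurable]: "f \<in> borel_measurable N" "g \<in> N \<rightarrow>\<^sub>M beliefs"
  shows "(\<lambda>w. opt_loss b k (f w) (g w)) \<in> borel_measurable N"
proof -
  have "(\<lambda>w. (f w, g w)) \<in> N \<rightarrow>\<^sub>M borel \<Otimes>\<^sub>M beliefs" by measurable
  from measurable_compose[OF this opt_loss_measurable_pair] show ?thesis by simp
qed

section \<open>Bounded offers, bounded beliefs and finite losses\<close>

lemma pred_eq_0:
  assumes "\<mu> \<in> space beliefs" and x: "M < \<bar>x\<bar>"
  shows "pred \<mu> x = 0"
proof -
  have "q x (fst z) = 0" if "z \<in> space \<mu>" for z
    using q_support[of "fst z" x] x that beliefsD(3)[OF assms(1)] by fastforce
  then have "pred \<mu> x = (\<integral>\<^sup>+z. 0 \<partial>\<mu>)"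
    unfolding pred_def by (intro nn_integral_cong) simp
  then show ?thesis by simp
qed

text \<open>The predictive density vanishes outside [-M, M], so only offers there need comparing.
  This lets inductions that assume offers at most \<open>b\<close> pass to the next offer.\<close>

lemma next_loss_mono:
  assumes "\<mu> \<in> space beliefs"
    and "\<And>x. \<bar>x\<bar> \<le> M \<Longrightarrow> W x (Psi Th q c x \<mu>) \<le> W' x (Psi Th q c x \<mu>)"
  shows "next_loss W \<mu> \<le> next_loss W' \<mu>"
  unfolding next_loss_def
proof (intro nn_integral_mono)
  show "pred \<mu> x * W x (Psi Th q c x \<mu>) \<le> pred \<mu> x * W' x (Psi Th q c x \<mu>)" for x
    using pred_eq_0[OF assms(1), of x] assms(2)[of x] by (cases "\<bar>x\<bar> \<le> M") (auto intro: mult_left_mono)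
qed

lemma next_loss_cong:
  assumes "\<mu> \<in> space beliefs"
    and "\<And>x. \<bar>x\<bar> \<le> M \<Longrightarrow> W x (Psi Th q c x \<mu>) = W' x (Psi Th q c x \<mu>)"
  shows "next_loss W \<mu> = next_loss W' \<mu>"
  by (intro antisym next_loss_mono) (use assms in auto)

lemma bounded_beliefD:
  assumes "bounded_belief Th \<mu>"
  shows "prob_space \<mu>" "sets \<mu> = sets (belief_space Th)" "\<mu> \<in> space beliefs"
  using assms
  by (auto simp: bounded_belief_def space_subprob_algebra prob_space_imp_subprob_space)

lemma bounded_beliefE:
  assumes "bounded_belief Th \<mu>"
  obtains B where "AE z in \<mu>. \<bar>snd z\<bar> \<le> B"
proof -
  obtain B' where "bounded B'" and AE: "AE z in \<mu>. snd z \<in> B'"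
    using assms by (auto simp: bounded_belief_def)
  then obtain B where "\<And>s. s \<in> B' \<Longrightarrow> \<bar>s\<bar> \<le> B"
    by (auto simp: bounded_iff)
  with AE show ?thesis by (intro that[of B]) auto
qed

lemma bounded_beliefI:
  assumes "prob_space \<mu>" "sets \<mu> = sets (belief_space Th)" "AE z in \<mu>. \<bar>snd z\<bar> \<le> B"
  shows "bounded_belief Th \<mu>"
  unfolding bounded_belief_def
proof (intro conjI exI[of _ "{-B..B}"])
  show "AE z in \<mu>. snd z \<in> {-B..B}" using assms(3) by eventually_elim auto
qed (use assms in auto)

text \<open>One update lowers the cost component by at most \<open>cu\<close>, so a bound
  \<open>B\<close> becomes \<open>B + cu\<close>; in the default case nothing changes. Hence the
  property holds at every offer and passes through inductions without null sets.\<close>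

lemma bounded_belief_Psi:
  assumes \<mu>: "bounded_belief Th \<mu>"
  shows "bounded_belief Th (Psi Th q c x \<mu>)"
proof (cases "0 < pred \<mu> x \<and> pred \<mu> x < \<infinity>")
  case True
  note s [measurable_cong] = bounded_beliefD(2)[OF \<mu>]
  have sp: "space \<mu> = Th \<times> {..0}"
    by (rule beliefsD[OF bounded_beliefD(3)[OF \<mu>]])
  obtain B where AE: "AE z in \<mu>. \<bar>snd z\<bar> \<le> B" using bounded_beliefE[OF \<mu>] .
  have "AE z in Psi Th q c x \<mu>. \<bar>snd z\<bar> \<le> B + cu"
  proof -
    have "AE z in \<mu>. \<bar>snd (shift z)\<bar> \<le> B + cu"
      using AE AE_space
    proof eventually_elim
      case (elim z)
      then show ?case using c_bounds[of "fst z"] by (auto simp: shift_def sp)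
    qed
    then have "AE z in density \<mu> (\<lambda>z. ennreal (q x (fst z)) / pred \<mu> x). \<bar>snd (shift z)\<bar> \<le> B + cu"
      by (subst AE_density) auto
    then show ?thesis
      unfolding Psi_eq[OF s] if_P[OF True] by (subst AE_distr_iff) measurable
  qed
  then show ?thesis
    using True by (intro bounded_beliefI Psi_prob_space sets_Psi s) auto
next
  case False
  then show ?thesis using \<mu> unfolding Psi_eq[OF bounded_beliefD(2)[OF \<mu>]] by (simp only: if_False)
qed

lemma U_avg_eq:
  assumes [measurable_cong]: "sets \<mu> = sets (belief_space Th)"
  shows "U_avg U \<mu> x = (\<integral>z. U (x + snd z) \<partial>\<mu>)"
proof -
  have [measurable]: "(\<lambda>s. s) \<in> cost_space \<rightarrow>\<^sub>M borel"
    by (rule measurable_restrict_space1) simp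
  show ?thesis
    unfolding U_avg_def marg_cost_def by (rule integral_distr) measurable
qed

text \<open>Cost components in [-B, 0] squeeze \<open>x + snd z\<close> between \<open>x - B\<close>
  and \<open>b\<close>: the left end makes the loss finite, the right end makes it
  untruncated.\<close>

lemma
  assumes \<mu>: "bounded_belief Th \<mu>" and x: "x \<le> b"
  shows U_avg_le: "U_avg U \<mu> x \<le> U b"
    and stop_loss_eq: "ennreal (U b - U_avg U \<mu> x) = stop_loss b x \<mu>"
    and integrable_U: "integrable \<mu> (\<lambda>z. U (x + snd z))"
proof -
  note s [measurable_cong] = bounded_beliefD(2)[OF \<mu>]
  interpret mu: prob_space \<mu> by (rule bounded_beliefD[OF \<mu>])
  have sp: "space \<mu> = Th \<times> {..0}"
    by (rule beliefsD[OF bounded_beliefD(3)[OF \<mu>]])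
  obtain B where AE: "AE z in \<mu>. \<bar>snd z\<bar> \<le> B" using bounded_beliefE[OF \<mu>] .
  have "stop_loss b x \<mu> \<le> (\<integral>\<^sup>+z. loss b (x - B) \<partial>\<mu>)"
    unfolding stop_loss_def
    by (intro nn_integral_mono_AE eventually_mono[OF AE] loss_antimono) auto
  also have "\<dots> < \<infinity>" by (simp add: mu.emeasure_space_1 loss_def)
  finally have fin: "stop_loss b x \<mu> < \<infinity>" .
  have le: "AE z in \<mu>. U (x + snd z) \<le> U b"
    using x sp by (intro AE_I2 U_mono) auto
  have [measurable]: "(\<lambda>z. U (x + snd z)) \<in> borel_measurable \<mu>" by measurable
  have "(\<integral>\<^sup>+z. ennreal (U b - U (x + snd z)) \<partial>\<mu>) = stop_loss b x \<mu>"
    by (simp add: stop_loss_def loss_def)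
  note * = mu.integral_eq_const_minus_nn_integral[OF _ le this fin]
  show "U_avg U \<mu> x \<le> U b" "ennreal (U b - U_avg U \<mu> x) = stop_loss b x \<mu>"
    "integrable \<mu> (\<lambda>z. U (x + snd z))"
    unfolding U_avg_eq[OF s] by (rule *; measurable)+
qed

text \<open>Bayes' rule exchanges the order of integration: for a fixed parameter the offers are at
  least \<open>-M\<close>, which bounds the loss uniformly.\<close>

lemma next_stop_loss_finite:
  assumes \<mu>: "bounded_belief Th \<mu>"
  shows "next_loss (stop_loss b) \<mu> < \<infinity>"
proof -
  note s [measurable_cong] = bounded_beliefD(2)[OF \<mu>]
  interpret mu: prob_space \<mu> by (rule bounded_beliefD[OF \<mu>])
  have sp: "space \<mu> = Th \<times> {..0}"
    by (rule beliefsD[OF bounded_beliefD(3)[OF \<mu>]])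
  obtain B where AE: "AE z in \<mu>. \<bar>snd z\<bar> \<le> B" using bounded_beliefE[OF \<mu>] .
  \<comment> \<open>Worst case: offer \<open>-M\<close>, accumulated cost \<open>B\<close>, one
    further cost \<open>cu\<close>.\<close>
  define A where "A = loss b (- M - B - cu)"
  have "next_loss (stop_loss b) \<mu> =
      (\<integral>\<^sup>+z. (\<integral>\<^sup>+x. ennreal (q x (fst z)) * loss b (x + snd (shift z)) \<partial>lam) \<partial>\<mu>)"
    unfolding next_loss_def stop_loss_def
    by (rule nn_integral_Bayes(1)[symmetric]) (use mu.prob_space_axioms s in auto)
  also have "\<dots> \<le> (\<integral>\<^sup>+z. A \<partial>\<mu>)"
    using AE AE_space
  proof (intro nn_integral_mono_AE, eventually_elim)
    fix z assume z: "\<bar>snd z\<bar> \<le> B" "z \<in> space \<mu>"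
    then have th: "fst z \<in> Th" using sp by auto
    have "ennreal (q x (fst z)) * loss b (x + snd (shift z)) \<le> ennreal (q x (fst z)) * A" for x
    proof (cases "q x (fst z) = 0")
      case False
      from q_support[OF th False] c_bounds[OF th] z show ?thesis
        unfolding A_def by (intro mult_left_mono loss_antimono) (auto simp: shift_def)
    qed simp
    then have "(\<integral>\<^sup>+x. ennreal (q x (fst z)) * loss b (x + snd (shift z)) \<partial>lam) \<le>
        (\<integral>\<^sup>+x. ennreal (q x (fst z)) * A \<partial>lam)"
      by (intro nn_integral_mono)
    also have "\<dots> = A"
      using nn_integral_q[OF th] th
      by (subst nn_integral_multc) auto
    finally show "(\<integral>\<^sup>+x. ennreal (q x (fst z)) * loss b (x + snd (shift z)) \<partial>lam) \<le> A" .
  qed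
  also have "\<dots> < \<infinity>" by (simp add: mu.emeasure_space_1 A_def loss_def)
  finally show ?thesis .
qed

lemma opt_loss_le_stop_loss: "opt_loss b k x \<mu> \<le> stop_loss b x \<mu>"
  by (cases k) auto

lemma next_opt_loss_finite:
  assumes "bounded_belief Th \<mu>"
  shows "next_loss (opt_loss b k) \<mu> < \<infinity>"
  using next_loss_mono[OF bounded_beliefD(3)[OF assms], of "opt_loss b k" "stop_loss b"]
    next_stop_loss_finite[OF assms, of b] opt_loss_le_stop_loss by (auto intro: le_less_trans)

lemma prob_space_QX:
  assumes \<mu>: "bounded_belief Th \<mu>"
  shows "prob_space (QX lam q (marg_param Th \<mu>))"
proof
  note s = bounded_beliefD[OF \<mu>]
  have "emeasure (QX lam q (marg_param Th \<mu>)) (space (QX lam q (marg_param Th \<mu>))) =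
      (\<integral>\<^sup>+x. 1 \<partial>QX lam q (marg_param Th \<mu>))" by simp
  also have "\<dots> = (\<integral>\<^sup>+x. pred \<mu> x \<partial>lam)" using s by (subst nn_integral_QX) auto
  also have "\<dots> = 1" by (rule nn_integral_Bayes(2)[OF s(1,2), of "\<lambda>_ _. 0"]) simp
  finally show "emeasure (QX lam q (marg_param Th \<mu>)) (space (QX lam q (marg_param Th \<mu>))) = 1" .
qed

lemma AE_QX:
  assumes \<mu>: "\<mu> \<in> space beliefs"
  shows "AE x in QX lam q (marg_param Th \<mu>). \<bar>x\<bar> \<le> M"
proof -
  have "\<bar>x\<bar> \<le> M" if "0 < pred \<mu> x" for x
    using pred_eq_0[OF \<mu>, of x] that by (cases "\<bar>x\<bar> \<le> M") auto
  then show ?thesis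
    unfolding QX_eq[OF beliefsD(1)[OF \<mu>]] using \<mu> by (subst AE_density) auto
qed

section \<open>Translation between values and losses\<close>

abbreviation "V \<equiv> Vfun Th lam q c U"

lemma ennreal_diff_max: "ennreal (a - max x y) = min (ennreal (a - x)) (ennreal (a - y))"
  by (cases "x \<le> y") (simp_all add: max_def min_absorb1 min_absorb2 ennreal_leI)

text \<open>The induction hypothesis is an explicit premise so that one argument serves the
  induction in \<open>V_loss\<close> and afterwards \<open>continuation_loss\<close>. It ranges over
  all levels \<open>b\<close>, which the measurability of the integrand requires.\<close>

lemma continuation_loss_step:
  assumes \<mu>: "bounded_belief Th \<mu>" and b: "M \<le> b"
    and IH: "\<And>b x \<mu>. bounded_belief Th \<mu> \<Longrightarrow> M \<le> b \<Longrightarrow> x \<le> b \<Longrightarrow>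
      V k x \<mu> \<le> U b \<and> ennreal (U b - V k x \<mu>) = opt_loss b k x \<mu>"
  shows "continuation Th lam q c (V k) \<mu> \<le> U b"
    "ennreal (U b - continuation Th lam q c (V k) \<mu>) = next_loss (opt_loss b k) \<mu>"
proof -
  note s = bounded_beliefD[OF \<mu>]
  interpret Q: prob_space "QX lam q (marg_param Th \<mu>)" by (rule prob_space_QX[OF \<mu>])
  define f where "f x = V k x (Psi Th q c x \<mu>)" for x
  have f: "f x \<le> U b" "ennreal (U b - f x) = opt_loss b k x (Psi Th q c x \<mu>)"
    if "M \<le> b" "x \<le> b" for x b
    using IH[OF bounded_belief_Psi[OF \<mu>] that] by (auto simp: f_def)
  have [measurable]: "\<mu> \<in> space beliefs" by (rule s)
  \<comment> \<open>For a single \<open>b\<close> the hypothesis describes \<open>f\<close> only on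
    offers up to \<open>b\<close>. With level \<open>M + n\<close> the measurable expression equals
    \<open>f x\<close> as soon as \<open>n \<ge> x - M\<close>, so \<open>f\<close> is a pointwise
    limit of measurable functions.\<close>
  have "f \<in> borel_measurable borel"
  proof (rule borel_measurable_LIMSEQ_real)
    fix x
    have "\<forall>\<^sub>F n in sequentially. x - M \<le> real n"
      by (rule eventually_compose_filterlim[OF eventually_ge_at_top filterlim_real_sequentially])
    then have "\<forall>\<^sub>F n in sequentially.
        U (M + real n) - enn2real (opt_loss (M + real n) k x (Psi Th q c x \<mu>)) = f x"
    proof eventually_elim
      case (elim n)
      then have "U (M + real n) - f x \<ge> 0"
        "opt_loss (M + real n) k x (Psi Th q c x \<mu>) = ennreal (U (M + real n) - f x)"
        using f[of "M + real n" x] by auto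
      then show ?case by (simp only: enn2real_ennreal)
    qed
    then show "(\<lambda>n. U (M + real n) - enn2real (opt_loss (M + real n) k x (Psi Th q c x \<mu>)))
      \<longlonglongrightarrow> f x"
      by (rule tendsto_eventually)
  qed measurable
  then have fm [measurable]: "f \<in> borel_measurable (QX lam q (marg_param Th \<mu>))"
    by (simp add: QX_def)
  have le: "AE x in QX lam q (marg_param Th \<mu>). f x \<le> U b"
    using AE_QX[OF s(3)] by eventually_elim (use f b in auto)
  have "(\<integral>\<^sup>+x. ennreal (U b - f x) \<partial>QX lam q (marg_param Th \<mu>)) =
      (\<integral>\<^sup>+x. opt_loss b k x (Psi Th q c x \<mu>) \<partial>QX lam q (marg_param Th \<mu>))"
    using AE_QX[OF s(3)] by (intro nn_integral_cong_AE, eventually_elim) (use f b in auto)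
  also have "\<dots> = next_loss (opt_loss b k) \<mu>"
    unfolding next_loss_def by (rule nn_integral_QX[OF s(3)]) measurable
  finally have I: "(\<integral>\<^sup>+x. ennreal (U b - f x) \<partial>QX lam q (marg_param Th \<mu>)) = next_loss (opt_loss b k) \<mu>" .
  from Q.integral_eq_const_minus_nn_integral[OF fm le I next_opt_loss_finite[OF \<mu>]]
  show "continuation Th lam q c (V k) \<mu> \<le> U b"
    "ennreal (U b - continuation Th lam q c (V k) \<mu>) = next_loss (opt_loss b k) \<mu>"
    by (auto simp: continuation_def f_def)
qed

text \<open>The bound is proved alongside the identity, since a truncated difference alone does not
  exclude \<open>V k x \<mu> > U b\<close>.\<close>

lemma V_loss:
  assumes "bounded_belief Th \<mu>" "M \<le> b" "x \<le> b"
  shows "V k x \<mu> \<le> U b \<and> ennreal (U b - V k x \<mu>) = opt_loss b k x \<mu>"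
  using assms
proof (induction k arbitrary: b x \<mu>)
  case 0
  then show ?case using U_avg_le stop_loss_eq by simp
next
  case (Suc k)
  show ?case
    using continuation_loss_step[OF Suc.prems(1,2) Suc.IH] U_avg_le[OF Suc.prems(1,3)]
      stop_loss_eq[OF Suc.prems(1,3)] by (simp add: ennreal_diff_max)
qed

lemma continuation_loss:
  assumes "bounded_belief Th \<mu>" "M \<le> b"
  shows "continuation Th lam q c (V k) \<mu> \<le> U b"
    "ennreal (U b - continuation Th lam q c (V k) \<mu>) = next_loss (opt_loss b k) \<mu>"
  using continuation_loss_step[OF assms V_loss] by auto

text \<open>With the payment fixed at \<open>M\<close>, waiting only deducts a nonnegative cost, and
  the offer density integrates to one.\<close>

lemma stop_loss_le_next_stop_loss:
  assumes \<mu>: "bounded_belief Th \<mu>"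
  shows "stop_loss b M \<mu> \<le> next_loss (\<lambda>_. stop_loss b M) \<mu>"
proof -
  note s [measurable_cong] = bounded_beliefD(2)[OF \<mu>]
  have sp: "space \<mu> = Th \<times> {..0}"
    by (rule beliefsD[OF bounded_beliefD(3)[OF \<mu>]])
  have "stop_loss b M \<mu> \<le> (\<integral>\<^sup>+z. (\<integral>\<^sup>+x. ennreal (q x (fst z)) * loss b (M + snd (shift z)) \<partial>lam) \<partial>\<mu>)"
    unfolding stop_loss_def
  proof (rule nn_integral_mono)
    fix z assume "z \<in> space \<mu>"
    then have th: "fst z \<in> Th" using sp by auto
    have "loss b (M + snd z) \<le> loss b (M + snd (shift z))"
      using c_bounds[OF th] by (intro loss_antimono) (auto simp: shift_def)
    also have "\<dots> = (\<integral>\<^sup>+x. ennreal (q x (fst z)) * loss b (M + snd (shift z)) \<partial>lam)"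
      using nn_integral_q[OF th] th
      by (subst nn_integral_multc) auto
    finally show "loss b (M + snd z) \<le> (\<integral>\<^sup>+x. ennreal (q x (fst z)) * loss b (M + snd (shift z)) \<partial>lam)" .
  qed
  also have "\<dots> = next_loss (\<lambda>_. stop_loss b M) \<mu>"
    unfolding next_loss_def stop_loss_def
    by (rule nn_integral_Bayes(1)) (use bounded_beliefD[OF \<mu>] in auto)
  finally show ?thesis .
qed

lemma stop_loss_antimono: "x \<le> y \<Longrightarrow> stop_loss b y \<mu> \<le> stop_loss b x \<mu>"
  unfolding stop_loss_def by (intro nn_integral_mono loss_antimono) auto

text \<open>Waiting only costs, so continuing is never better than being paid the largest offer \<open>M\<close> now.
  This places the continuation value in the range of \<open>U_avg U \<mu>\<close>.\<close>

lemma stop_loss_le_next_loss: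
  assumes "bounded_belief Th \<mu>"
  shows "stop_loss b M \<mu> \<le> next_loss (opt_loss b k) \<mu>"
  using assms
proof (induction k arbitrary: \<mu>)
  case 0
  note stop_loss_le_next_stop_loss[OF 0]
  also have "next_loss (\<lambda>_. stop_loss b M) \<mu> \<le> next_loss (opt_loss b 0) \<mu>"
    by (intro next_loss_mono bounded_beliefD[OF 0]) (simp add: stop_loss_antimono)
  finally show ?case .
next
  case (Suc k)
  note stop_loss_le_next_stop_loss[OF Suc.prems]
  \<comment> \<open>Both branches of the minimum are at least \<open>stop_loss b M\<close>: stopping
    because \<open>x \<le> M\<close>, continuing by the induction hypothesis for the updated
    belief.\<close>
  also have "next_loss (\<lambda>_. stop_loss b M) \<mu> \<le> next_loss (opt_loss b (Suc k)) \<mu>"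
    using Suc.IH[OF bounded_belief_Psi[OF Suc.prems]]
    by (intro next_loss_mono bounded_beliefD[OF Suc.prems]) (simp add: stop_loss_antimono)
  finally show ?case .
qed

lemma continuation_le_U_avg:
  assumes \<mu>: "bounded_belief Th \<mu>"
  shows "continuation Th lam q c (V k) \<mu> \<le> U_avg U \<mu> M"
proof -
  have "ennreal (U M - U_avg U \<mu> M) \<le> ennreal (U M - continuation Th lam q c (V k) \<mu>)"
    using stop_loss_le_next_loss[OF \<mu>, of M k] by (simp add: stop_loss_eq continuation_loss \<mu>)
  then show ?thesis
    using continuation_loss(1)[OF \<mu>, of M k] U_avg_le[OF \<mu>, of M M] by (simp add: ennreal_le_iff)
qed

section \<open>Inverting the averaged utility\<close>

lemma U_avg_strict_mono:
  assumes \<mu>: "bounded_belief Th \<mu>"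
  shows "strict_mono (U_avg U \<mu>)"
proof (rule strict_monoI)
  fix x y :: real assume xy: "x < y"
  interpret mu: prob_space \<mu> by (rule bounded_beliefD[OF \<mu>])
  show "U_avg U \<mu> x < U_avg U \<mu> y"
    unfolding U_avg_eq[OF bounded_beliefD(2)[OF \<mu>]]
    by (rule mu.integral_less_AE_space)
      (use xy U_strict_mono integrable_U[OF \<mu> order_refl] in \<open>auto simp: strict_mono_less mu.emeasure_space_1\<close>)
qed

text \<open>Averaging translates preserves concavity, and a finite concave function on the real line
  is continuous.\<close>

lemma U_avg_continuous:
  assumes \<mu>: "bounded_belief Th \<mu>"
  shows "continuous_on UNIV (U_avg U \<mu>)"
proof -
  note int = integrable_U[OF \<mu> order_refl]
  have "concave_on UNIV (U_avg U \<mu>)"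
    unfolding concave_on_iff
  proof (intro conjI ballI allI impI)
    fix x y u v :: real assume uv: "0 \<le> u" "0 \<le> v" "u + v = 1"
    have "u * U_avg U \<mu> x + v * U_avg U \<mu> y = (\<integral>z. u * U (x + snd z) + v * U (y + snd z) \<partial>\<mu>)"
      using int by (simp add: U_avg_eq[OF bounded_beliefD(2)[OF \<mu>]])
    also have "\<dots> \<le> (\<integral>z. U (u *\<^sub>R x + v *\<^sub>R y + snd z) \<partial>\<mu>)"
    proof (intro integral_mono int)
      fix z :: "'a \<times> real"
      have "u * U (x + snd z) + v * U (y + snd z) \<le> U (u *\<^sub>R (x + snd z) + v *\<^sub>R (y + snd z))"
        using U_concave uv unfolding concave_on_iff by auto
      also have "u *\<^sub>R (x + snd z) + v *\<^sub>R (y + snd z) = u *\<^sub>R x + v *\<^sub>R y + (u + v) * snd z"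
        by (simp add: algebra_simps)
      finally show "u * U (x + snd z) + v * U (y + snd z) \<le> U (u *\<^sub>R x + v *\<^sub>R y + snd z)"
        using uv by simp
    qed (use int in auto)
    finally show "u * U_avg U \<mu> x + v * U_avg U \<mu> y \<le> U_avg U \<mu> (u *\<^sub>R x + v *\<^sub>R y)"
      by (simp add: U_avg_eq[OF bounded_beliefD(2)[OF \<mu>]])
  qed simp
  then have "continuous_on UNIV (\<lambda>x. - U_avg U \<mu> x)"
    unfolding concave_on_def by (intro convex_on_continuous) auto
  from continuous_on_minus[OF this] show ?thesis by simp
qed

text \<open>Left of 0 a concave function lies below its chord line through 0 and 1, whose slope is
  positive by strict monotonicity.\<close>

lemma U_unbounded_below: "\<exists>x. U x \<le> d"
proof -
  define D where "D = U 1 - U 0"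
  \<comment> \<open>Distance to the left of 0 at which that line has fallen by
    \<open>\<bar>U 0 - d\<bar>\<close>. The weights below write 0 as a convex combination of 1 and
    \<open>-t\<close>.\<close>
  define t where "t = \<bar>U 0 - d\<bar> / D"
  have D: "0 < D" using U_strict_mono by (simp add: D_def strict_mono_less)
  then have t: "0 \<le> t" by (simp add: t_def)
  have uv: "0 \<le> t / (1 + t)" "0 \<le> 1 / (1 + t)" "t / (1 + t) + 1 / (1 + t) = 1"
    using t by (auto simp: add_divide_distrib[symmetric])
  then have "t / (1 + t) * U 1 + 1 / (1 + t) * U (- t) \<le> U ((t / (1 + t)) *\<^sub>R 1 + (1 / (1 + t)) *\<^sub>R (- t))"
    using U_concave unfolding concave_on_iff by blast
  also have "(t / (1 + t)) *\<^sub>R 1 + (1 / (1 + t)) *\<^sub>R (- t) = 0" by simp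
  finally have "(t * U 1 + U (- t)) / (1 + t) \<le> U 0" by (simp add: add_divide_distrib)
  then have "t * U 1 + U (- t) \<le> (1 + t) * U 0" using t by (simp add: pos_divide_le_eq mult.commute)
  then have "U (- t) \<le> U 0 - t * D" by (simp add: D_def algebra_simps)
  also have "\<dots> \<le> d" using D by (simp add: t_def)
  finally show ?thesis by blast
qed

text \<open>\<open>inv\<close> picks a preimage, so it is a right inverse only on the range. The
  range contains \<open>d\<close> by the intermediate value theorem between \<open>M\<close> and a
  point \<open>a\<close> with \<open>U a \<le> d\<close>, where
  \<open>U_avg U \<mu> a \<le> U a\<close> because the cost component is nonpositive.\<close>

lemma U_avg_inv:
  assumes \<mu>: "bounded_belief Th \<mu>" and d: "d \<le> U_avg U \<mu> M"
  shows "U_avg U \<mu> (inv (U_avg U \<mu>) d) = d"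
proof -
  obtain a where a: "U a \<le> d" using U_unbounded_below by blast
  then have ad: "U_avg U \<mu> a \<le> d" using U_avg_le[OF \<mu>, of a a] by simp
  with d have "U_avg U \<mu> a \<le> U_avg U \<mu> M" by simp
  then have "a \<le> M" using U_avg_strict_mono[OF \<mu>] by (simp add: strict_mono_less_eq)
  then obtain x where "U_avg U \<mu> x = d"
    using IVT'[of "U_avg U \<mu>" a d M] ad d continuous_on_subset[OF U_avg_continuous[OF \<mu>]] by auto
  then show ?thesis by (intro f_inv_into_f) auto
qed

section \<open>Reservation levels and their recursion\<close>

lemma U_avg_xstar:
  assumes \<mu>: "bounded_belief Th \<mu>"
  shows "U_avg U \<mu> (xstar Th lam q c U N n \<mu>) = dval Th lam q c U (N - n) \<mu>"
  unfolding xstar_def dval_def by (intro U_avg_inv \<mu> continuation_le_U_avg)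

text \<open>A monotone function commutes with maxima, so the integrand is the larger of stopping
  value and next continuation value at the updated belief, that is, \<open>V\<close>.\<close>

lemma xstar_recursion:
  assumes \<mu>: "bounded_belief Th \<mu>" and n: "n + 2 \<le> N"
  shows "dval Th lam q c U (N - n) \<mu> =
    (\<integral>x. U_avg U (Psi Th q c x \<mu>) (max x (xstar Th lam q c U N (n + 1) (Psi Th q c x \<mu>)))
       \<partial>QX lam q (marg_param Th \<mu>))"
proof -
  \<comment> \<open>The bound on \<open>n\<close> makes \<open>N - (n + 1)\<close> positive, so the
    \<open>V\<close> integrated in \<open>dval\<close> has a successor index and is defined by a
    maximum.\<close>
  obtain k where k: "N - n = Suc (Suc k)" "N - (n + 1) = Suc k"
    using n by (intro that[of "N - n - 2"]) auto
  have "U_avg U \<nu> (max x (xstar Th lam q c U N (n + 1) \<nu>)) = V (Suc k) x \<nu>"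
    if "bounded_belief Th \<nu>" for x \<nu>
    using U_avg_xstar[OF that, of N "n + 1"] U_avg_strict_mono[OF that] k
    by (subst max_of_mono[symmetric]) (simp_all add: strict_mono_mono dval_def del: One_nat_def)
  then show ?thesis
    using k by (simp add: dval_def continuation_def bounded_belief_Psi[OF \<mu>])
qed

text \<open>Reaching the level means that stopping is at least as good as continuing; ties count as
  stopping on both sides. The right-hand side compares measurable quantities and fits the minimum in
  \<open>opt_loss\<close>.\<close>

lemma xstar_le_iff:
  assumes \<mu>: "bounded_belief Th \<mu>" and k: "N - n = Suc k" and b: "M \<le> b" "x \<le> b"
  shows "xstar Th lam q c U N n \<mu> \<le> x \<longleftrightarrow> stop_loss b x \<mu> \<le> next_loss (opt_loss b k) \<mu>"
proof -
  have "xstar Th lam q c U N n \<mu> \<le> x \<longleftrightarrow> continuation Th lam q c (V k) \<mu> \<le> U_avg U \<mu> x"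
    using U_avg_xstar[OF \<mu>, of N n] U_avg_strict_mono[OF \<mu>] k
    by (metis dval_def diff_Suc_1 strict_mono_less_eq)
  also have "\<dots> \<longleftrightarrow> ennreal (U b - U_avg U \<mu> x) \<le> ennreal (U b - continuation Th lam q c (V k) \<mu>)"
    using continuation_loss(1)[OF \<mu> b(1), of k] by (simp add: ennreal_le_iff)
  finally show ?thesis by (simp add: stop_loss_eq continuation_loss \<mu> b)
qed

end

subsection \<open>Paths of offers\<close>

lemma space_path_space: "space (path_space n) = extensional {..n}"
  by (simp add: space_PiM PiE_def)

lemma fun_upd_path_space: "h \<in> space (path_space n) \<Longrightarrow> h(Suc n := x) \<in> space (path_space (Suc n))"
  by (auto simp: space_path_space extensional_def)

lemma path_space_restrict: "h \<in> space (path_space n) \<Longrightarrow> restrict h {..n} = h"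
  by (simp add: space_path_space extensional_restrict)

lemma restrict_fun_upd_Suc:
  assumes "h \<in> space (path_space n)" "restrict \<omega> {..Suc n} = h(Suc n := x)"
  shows "restrict \<omega> {..n} = h"
proof
  fix i show "restrict \<omega> {..n} i = h i"
    using assms(1) fun_cong[OF assms(2), of i] by (auto simp: space_path_space extensional_def split: if_splits)
qed

lemma fun_upd_measurable_path [measurable (raw)]:
  assumes "f \<in> N \<rightarrow>\<^sub>M path_space n" "g \<in> borel_measurable N"
  shows "(\<lambda>w. (f w)(Suc n := g w)) \<in> N \<rightarrow>\<^sub>M path_space (Suc n)"
  using assms by (intro measurable_fun_upd[where J = "{..n}"]) auto

text \<open>Filtration indices range over all naturals; beyond the horizon coordinates are
  constantly \<open>undefined\<close>, hence still measurable.\<close>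

lemma component_measurable_path:
  "(\<lambda>\<omega>. \<omega> i) \<in> borel_measurable (path_space N)"
proof (cases "i \<le> N")
  case False
  then have "\<omega> i = undefined" if "\<omega> \<in> space (path_space N)" for \<omega>
    using that by (simp add: space_path_space extensional_def)
  then show ?thesis by (subst measurable_cong[of _ _ "\<lambda>_. undefined"]) auto
qed simp

lemma restrict_measurable_path:
  "(\<lambda>\<omega>. restrict \<omega> {..n}) \<in> path_space N \<rightarrow>\<^sub>M path_space n"
  by (intro measurable_restrict component_measurable_path)

lemma space_offer_filtration: "space (offer_filtration N n) = space (path_space N)"
  by (simp add: offer_filtration_def)

lemma admissible_measurable:
  assumes "T \<in> admissible N"
  shows "T \<in> path_space N \<rightarrow>\<^sub>M count_space {..N}"
proof -
  have sub: "sets (offer_filtration N t) \<subseteq> sets (path_space N)" for t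
    unfolding offer_filtration_def by (rule sets_image_in_sets[OF refl restrict_measurable_path])
  have "stopping_time (offer_filtration N) T" using assms by (simp add: admissible_def)
  then have "T \<in> path_space N \<rightarrow>\<^sub>M borel"
    by (rule measurable_stopping_time) (rule sub space_offer_filtration)+
  from measurable_sets[OF this] have "T -` {a} \<inter> space (path_space N) \<in> sets (path_space N)" for a
    by simp
  then show ?thesis
    using assms by (auto simp: measurable_count_space_eq2 admissible_def)
qed

text \<open>An event of the \<open>n\<close>-th sigma-algebra is the preimage of a set of prefixes,
  so it cannot separate paths agreeing up to \<open>n\<close>. This turns adaptedness into a
  pathwise statement.\<close>

lemma admissible_prefix:
  assumes T: "T \<in> admissible N"
    and \<omega>: "\<omega> \<in> space (path_space N)" "\<omega>' \<in> space (path_space N)"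
    and eq: "restrict \<omega> {..n} = restrict \<omega>' {..n}" and le: "T \<omega> \<le> n"
  shows "T \<omega>' \<le> n"
proof -
  have "{\<omega> \<in> space (offer_filtration N n). T \<omega> \<le> n} \<in> sets (offer_filtration N n)"
    using T stopping_timeD[of "offer_filtration N" T n] by (auto simp: admissible_def Measurable.pred_def)
  then have "{\<omega> \<in> space (path_space N). T \<omega> \<le> n} \<in>
      {(\<lambda>\<omega>. restrict \<omega> {..n}) -` A \<inter> space (path_space N) | A. A \<in> sets (path_space n)}"
    unfolding space_offer_filtration unfolding offer_filtration_def
    by (subst (asm) sets_vimage_algebra2) (auto simp: space_path_space)
  then obtain A where A: "{\<omega> \<in> space (path_space N). T \<omega> \<le> n} = (\<lambda>\<omega>. restrict \<omega> {..n}) -` A \<inter> space (path_space N)"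
    by blast
  have "\<omega> \<in> {\<omega> \<in> space (path_space N). T \<omega> \<le> n}" using le \<omega> by simp
  then have "restrict \<omega>' {..n} \<in> A" unfolding A using eq by auto
  then have "\<omega>' \<in> {\<omega> \<in> space (path_space N). T \<omega> \<le> n}" unfolding A using \<omega> by auto
  then show ?thesis by simp
qed

lemma belief_cong:
  "(\<And>i. 1 \<le> i \<Longrightarrow> i \<le> n \<Longrightarrow> h i = h' i) \<Longrightarrow> belief Th q c Q0 n h = belief Th q c Q0 n h'"
  by (induction n) auto

section \<open>Iterated integrals over the remaining offers\<close>

context house_selling begin

text \<open>Expectation of \<open>F\<close> over the next \<open>k\<close> offers, given the parameter \<open>\<theta>\<close> and the offers
  \<open>h 0, \<dots>, h n\<close> seen so far.\<close>

primrec future :: "nat \<Rightarrow> nat \<Rightarrow> 'a \<Rightarrow> ((nat \<Rightarrow> real) \<Rightarrow> ennreal) \<Rightarrow> (nat \<Rightarrow> real) \<Rightarrow> ennreal" where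
  "future 0 n \<theta> F h = F h"
| "future (Suc k) n \<theta> F h = (\<integral>\<^sup>+x. ennreal (q x \<theta>) * future k (Suc n) \<theta> F (h(Suc n := x)) \<partial>lam)"

text \<open>Parameter and integrand vary together with \<open>w\<close>, because in
  \<open>rule_loss\<close> the drawn pair enters the offer density as well as the path loss.\<close>

lemma future_measurable_pair:
  assumes g [measurable]: "g \<in> N \<rightarrow>\<^sub>M param_space Th"
    and "(\<lambda>w. F (fst w) (snd w)) \<in> borel_measurable (N \<Otimes>\<^sub>M path_space (n + k))"
  shows "(\<lambda>w. future k n (g (fst w)) (F (fst w)) (snd w)) \<in> borel_measurable (N \<Otimes>\<^sub>M path_space n)"
  using assms(2)
proof (induction k arbitrary: n)
  case (Suc k)
  have IH: "(\<lambda>w. future k (Suc n) (g (fst w)) (F (fst w)) (snd w)) \<in> borel_measurable (N \<Otimes>\<^sub>M path_space (Suc n))"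
    using Suc.prems by (intro Suc.IH) simp
  have "(\<lambda>v. (fst (fst v), (snd (fst v))(Suc n := snd v))) \<in>
      (N \<Otimes>\<^sub>M path_space n) \<Otimes>\<^sub>M lam \<rightarrow>\<^sub>M N \<Otimes>\<^sub>M path_space (Suc n)"
    by measurable
  from measurable_compose[OF this IH]
  have [measurable]: "(\<lambda>v. future k (Suc n) (g (fst (fst v))) (F (fst (fst v))) ((snd (fst v))(Suc n := snd v)))
    \<in> borel_measurable ((N \<Otimes>\<^sub>M path_space n) \<Otimes>\<^sub>M lam)" by simp
  show ?case by simp
qed simp

lemma future_measurable:
  assumes \<theta>: "\<theta> \<in> Th" and [measurable]: "F \<in> borel_measurable (path_space (n + k))"
  shows "future k n \<theta> F \<in> borel_measurable (path_space n)"
proof -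
  \<comment> \<open>A one-point space supplies the constant parameter.\<close>
  have "(\<lambda>w. future k n \<theta> F (snd w)) \<in> borel_measurable (count_space (UNIV :: unit set) \<Otimes>\<^sub>M path_space n)"
    using \<theta> by (intro future_measurable_pair[of "\<lambda>_::unit. \<theta>" _ "\<lambda>_. F"]) (auto simp: space_restrict_space)
  from measurable_compose[OF measurable_Pair1' this, of "()"] show ?thesis by simp
qed

lemma future_const:
  assumes \<theta>: "\<theta> \<in> Th" and "h \<in> space (path_space n)"
    and "\<And>\<omega>. \<omega> \<in> space (path_space (n + k)) \<Longrightarrow> restrict \<omega> {..n} = h \<Longrightarrow> F \<omega> = C"
  shows "future k n \<theta> F h = C"
  using assms(2-)
proof (induction k arbitrary: n h)
  case 0
  then show ?case using 0(2)[OF _ path_space_restrict[OF 0(1)]] by simp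
next
  case (Suc k)
  have "future k (Suc n) \<theta> F (h(Suc n := x)) = C" for x
  proof (intro Suc.IH fun_upd_path_space Suc.prems(1))
    fix \<omega> assume "\<omega> \<in> space (path_space (Suc n + k))" "restrict \<omega> {..Suc n} = h(Suc n := x)"
    then show "F \<omega> = C"
      by (intro Suc.prems(2) restrict_fun_upd_Suc[OF Suc.prems(1)]) auto
  qed
  then show ?case
    using nn_integral_q[OF \<theta>] \<theta> by (simp add: nn_integral_multc)
qed

abbreviation "offer_laws x \<theta> \<equiv> (\<lambda>i::nat. if i = 0 then return borel x else offer_dist lam q \<theta>)"

lemma sets_offer_laws: "sets (offer_laws x \<theta> i) = sets borel"
  by (simp add: offer_dist_def sets_lam)

lemma sets_PiM_offer_laws: "sets (PiM I (offer_laws x \<theta>)) = sets (PiM I (\<lambda>_. borel))"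
  by (intro sets_PiM_cong refl sets_offer_laws)

lemma prob_space_offer_laws: "\<theta> \<in> Th \<Longrightarrow> prob_space (offer_laws x \<theta> i)"
  by (simp add: prob_space_offer_dist prob_space_return)

text \<open>The induction hypothesis handles the offers after \<open>Suc n\<close>; coordinate
  \<open>Suc n\<close> is then split off the product measure.\<close>

lemma nn_integral_PiM_future:
  assumes \<theta>: "\<theta> \<in> Th" and "F \<in> borel_measurable (path_space (n + k))"
  shows "(\<integral>\<^sup>+\<omega>. F \<omega> \<partial>PiM {..n + k} (offer_laws x \<theta>)) =
    (\<integral>\<^sup>+h. future k n \<theta> F h \<partial>PiM {..n} (offer_laws x \<theta>))"
  using assms(2)
proof (induction k arbitrary: n)
  case 0
  have "future 0 n \<theta> F = F" by (rule ext) simp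
  then show ?case by simp
next
  case (Suc k)
  interpret product_sigma_finite "offer_laws x \<theta>"
    by (rule product_sigma_finite.intro) (intro prob_space_imp_sigma_finite prob_space_offer_laws \<theta>)
  have F: "F \<in> borel_measurable (path_space (Suc n + k))" using Suc.prems by simp
  note m [measurable] = future_measurable[OF \<theta> F]
  have "(\<integral>\<^sup>+\<omega>. F \<omega> \<partial>PiM {..n + Suc k} (offer_laws x \<theta>)) =
      (\<integral>\<^sup>+h. future k (Suc n) \<theta> F h \<partial>PiM (insert (Suc n) {..n}) (offer_laws x \<theta>))"
    using Suc.IH[OF F] by (simp add: atMost_Suc)
  also have "\<dots> = (\<integral>\<^sup>+h. (\<integral>\<^sup>+y. future k (Suc n) \<theta> F (h(Suc n := y)) \<partial>offer_laws x \<theta> (Suc n))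
      \<partial>PiM {..n} (offer_laws x \<theta>))"
    using m by (intro product_nn_integral_insert)
      (auto simp: measurable_cong_sets[OF sets_PiM_offer_laws refl] atMost_Suc)
  also have "\<dots> = (\<integral>\<^sup>+h. future (Suc k) n \<theta> F h \<partial>PiM {..n} (offer_laws x \<theta>))"
  proof (intro nn_integral_cong)
    fix h assume "h \<in> space (PiM {..n} (offer_laws x \<theta>))"
    then have [measurable]: "h \<in> space (path_space n)"
      using sets_eq_imp_space_eq[OF sets_PiM_offer_laws] by auto
    have "(\<lambda>y. future k (Suc n) \<theta> F (h(Suc n := y))) \<in> borel_measurable borel"
      by (rule measurable_compose[OF _ m]) measurable
    then show "(\<integral>\<^sup>+y. future k (Suc n) \<theta> F (h(Suc n := y)) \<partial>offer_laws x \<theta> (Suc n)) =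
        future (Suc k) n \<theta> F h"
      by (simp add: nn_integral_offer_dist[OF \<theta>])
  qed
  finally show ?case .
qed

text \<open>At time 0 a single coordinate is left, and its law is the point mass at
  \<open>x\<close>.\<close>

lemma nn_integral_offer_law:
  assumes \<theta>: "\<theta> \<in> Th" and F: "F \<in> borel_measurable (path_space N)"
  shows "(\<integral>\<^sup>+\<omega>. F \<omega> \<partial>offer_law lam q N x \<theta>) = future N 0 \<theta> F (\<lambda>i\<in>{..0}. x)"
proof -
  interpret product_sigma_finite "offer_laws x \<theta>"
    by (rule product_sigma_finite.intro) (intro prob_space_imp_sigma_finite prob_space_offer_laws \<theta>)
  have m: "future N 0 \<theta> F \<in> borel_measurable (path_space 0)"
    using F by (intro future_measurable[OF \<theta>]) simp
  have m': "(\<lambda>y. future N 0 \<theta> F (\<lambda>i\<in>{..0}. y)) \<in> borel_measurable borel"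
    by (rule measurable_compose[OF _ m]) (intro measurable_restrict measurable_ident_sets refl)
  have "(\<integral>\<^sup>+\<omega>. F \<omega> \<partial>offer_law lam q N x \<theta>) = (\<integral>\<^sup>+h. future N 0 \<theta> F h \<partial>PiM {..0} (offer_laws x \<theta>))"
    using nn_integral_PiM_future[OF \<theta>, of F 0 N x] F by (simp add: offer_law_def)
  also have "\<dots> = (\<integral>\<^sup>+h. future N 0 \<theta> F (\<lambda>i\<in>{..0}. h 0) \<partial>PiM {..0} (offer_laws x \<theta>))"
  proof (intro nn_integral_cong arg_cong[where f = "future N 0 \<theta> F"])
    show "h = (\<lambda>i\<in>{..0}. h 0)" if "h \<in> space (PiM {..0} (offer_laws x \<theta>))" for h
      using that by (auto simp: space_PiM PiE_def extensional_def fun_eq_iff)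
  qed
  also have "\<dots> = (\<integral>\<^sup>+y. future N 0 \<theta> F (\<lambda>i\<in>{..0}. y) \<partial>offer_laws x \<theta> 0)"
  proof -
    have 0: "{..0} = {0::nat}" by simp
    show ?thesis
      using m' unfolding 0 by (intro product_nn_integral_singleton) simp
  qed
  also have "\<dots> = future N 0 \<theta> F (\<lambda>i\<in>{..0}. x)"
    using m' by (simp add: nn_integral_return)
  finally show ?thesis .
qed

text \<open>Costs are charged from time \<open>n\<close> on, since \<open>snd z\<close> already
  contains the earlier ones. The difference is real-valued, so going from \<open>n\<close> to
  \<open>Suc n\<close> moves exactly one cost on every path, whatever \<open>T\<close> does
  there.\<close>

definition path_loss :: "real \<Rightarrow> ((nat \<Rightarrow> real) \<Rightarrow> nat) \<Rightarrow> nat \<Rightarrow> 'a \<times> real \<Rightarrow> (nat \<Rightarrow> real) \<Rightarrow> ennreal" where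
  "path_loss b T n z \<omega> = loss b (\<omega> (T \<omega>) + snd z - c (fst z) * (real (T \<omega>) - real n))"

text \<open>A version, defined at every history, of the conditional expected loss of
  \<open>T\<close> when \<mu> is the belief at \<open>h\<close>.\<close>

definition rule_loss :: "real \<Rightarrow> ((nat \<Rightarrow> real) \<Rightarrow> nat) \<Rightarrow> nat \<Rightarrow> nat \<Rightarrow> (nat \<Rightarrow> real) \<Rightarrow> ('a \<times> real) measure \<Rightarrow> ennreal" where
  "rule_loss b T k n h \<mu> = (\<integral>\<^sup>+z. future k n (fst z) (path_loss b T n z) h \<partial>\<mu>)"

lemma stopped_measurable:
  assumes T: "T \<in> path_space N \<rightarrow>\<^sub>M count_space {..N}"
  shows "(\<lambda>\<omega>. \<omega> (T \<omega>)) \<in> borel_measurable (path_space N)" "(\<lambda>\<omega>. real (T \<omega>)) \<in> borel_measurable (path_space N)"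
proof -
  show "(\<lambda>\<omega>. \<omega> (T \<omega>)) \<in> borel_measurable (path_space N)"
    by (rule measurable_compose_countable'[OF component_measurable_path T]) auto
  show "(\<lambda>\<omega>. real (T \<omega>)) \<in> borel_measurable (path_space N)"
    by (rule measurable_compose[OF T]) simp
qed

lemma path_loss_measurable:
  assumes T: "T \<in> path_space N \<rightarrow>\<^sub>M count_space {..N}"
  shows "(\<lambda>w. path_loss b T n (fst w) (snd w)) \<in> borel_measurable (belief_space Th \<Otimes>\<^sub>M path_space N)"
proof -
  note [measurable] = stopped_measurable[OF T]
  show ?thesis unfolding path_loss_def by measurable
qed

text \<open>Bayes' rule for the next offer; the cost of rejecting moves from the path into the
  belief through \<open>shift\<close>.\<close>

lemma rule_loss_Suc:
  assumes T: "T \<in> path_space N \<rightarrow>\<^sub>M count_space {..N}" and N: "n + Suc k = N"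
    and h [measurable]: "h \<in> space (path_space n)" and \<mu>: "bounded_belief Th \<mu>"
  shows "rule_loss b T (Suc k) n h \<mu> = next_loss (\<lambda>x. rule_loss b T k (Suc n) (h(Suc n := x))) \<mu>"
proof -
  define G where "G x z = future k (Suc n) (fst z) (path_loss b T (Suc n) z) (h(Suc n := x))" for x z
  have "(\<lambda>w. future k (Suc n) (fst (fst w)) (path_loss b T (Suc n) (fst w)) (snd w)) \<in>
      borel_measurable (belief_space Th \<Otimes>\<^sub>M path_space (Suc n))"
    using path_loss_measurable[OF T] N by (intro future_measurable_pair) auto
  from measurable_compose[OF _ this, of "\<lambda>w. (snd w, h(Suc n := fst w))" "borel \<Otimes>\<^sub>M belief_space Th"]
  have G: "(\<lambda>(x, z). G x z) \<in> borel_measurable (borel \<Otimes>\<^sub>M belief_space Th)"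
    by (simp add: G_def split_beta')
  have fst_shift: "fst (shift z) = fst z" for z by (simp add: shift_def)
  have "path_loss b T n z = path_loss b T (Suc n) (shift z)" for z
    by (simp add: path_loss_def shift_def fun_eq_iff algebra_simps)
  then have "rule_loss b T (Suc k) n h \<mu> = (\<integral>\<^sup>+z. (\<integral>\<^sup>+x. ennreal (q x (fst z)) * G x (shift z) \<partial>lam) \<partial>\<mu>)"
    by (simp add: rule_loss_def G_def fst_shift)
  also have "\<dots> = (\<integral>\<^sup>+x. pred \<mu> x * (\<integral>\<^sup>+z. G x z \<partial>Psi Th q c x \<mu>) \<partial>lam)"
    by (rule nn_integral_Bayes(1)[OF bounded_beliefD(1,2)[OF \<mu>] G])
  finally show ?thesis by (simp add: next_loss_def rule_loss_def G_def)
qed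

lemma rule_loss_stop:
  assumes h: "h \<in> space (path_space n)" and \<mu>: "bounded_belief Th \<mu>"
    and T: "\<And>\<omega>. \<omega> \<in> space (path_space (n + k)) \<Longrightarrow> restrict \<omega> {..n} = h \<Longrightarrow> T \<omega> = n"
  shows "rule_loss b T k n h \<mu> = stop_loss b (h n) \<mu>"
  unfolding rule_loss_def stop_loss_def
proof (intro nn_integral_cong future_const h)
  fix z \<omega> assume "z \<in> space \<mu>"
  then show "fst z \<in> Th" using beliefsD(3)[OF bounded_beliefD(3)[OF \<mu>]] by auto
  assume \<omega>: "\<omega> \<in> space (path_space (n + k))" "restrict \<omega> {..n} = h"
  then show "path_loss b T n z \<omega> = loss b (h n + snd z)"
    using T[OF \<omega>] by (auto simp: path_loss_def)
qed

text \<open>The bound is proved at every history at which \<open>T\<close> is still running, so no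
  exceptional sets arise. By adaptedness, either all continuations of \<open>h\<close> stop at
  \<open>n\<close> or none does.\<close>

lemma opt_loss_le_rule_loss:
  assumes T: "T \<in> admissible N" and "bounded_belief Th \<mu>" and "n + k = N"
    and "h \<in> space (path_space n)"
    and "\<And>\<omega>. \<omega> \<in> space (path_space N) \<Longrightarrow> restrict \<omega> {..n} = h \<Longrightarrow> n \<le> T \<omega>"
  shows "opt_loss b k (h n) \<mu> \<le> rule_loss b T k n h \<mu>"
  using assms(2-)
proof (induction k arbitrary: n h \<mu>)
  case 0
  have "T \<omega> = n" if "\<omega> \<in> space (path_space (n + 0))" "restrict \<omega> {..n} = h" for \<omega>
  proof (rule antisym)
    show "T \<omega> \<le> n" using that(1) 0(2) T unfolding admissible_def by simp
    show "n \<le> T \<omega>" using 0(4)[OF _ that(2)] that(1) 0(2) by simp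
  qed
  then have "rule_loss b T 0 n h \<mu> = stop_loss b (h n) \<mu>"
    by (rule rule_loss_stop[OF 0(3,1)])
  then show ?case by simp
next
  case (Suc k)
  show ?case
  proof (cases "\<exists>\<omega>\<in>space (path_space N). restrict \<omega> {..n} = h \<and> T \<omega> \<le> n")
    case True
    then obtain \<omega>' where \<omega>': "\<omega>' \<in> space (path_space N)" "restrict \<omega>' {..n} = h" "T \<omega>' \<le> n"
      by blast
    have "T \<omega> = n" if "\<omega> \<in> space (path_space (n + Suc k))" "restrict \<omega> {..n} = h" for \<omega>
    proof (rule antisym)
      have \<omega>: "\<omega> \<in> space (path_space N)" using that(1) unfolding Suc.prems(2) .
      show "T \<omega> \<le> n"
        by (rule admissible_prefix[OF T \<omega>'(1) \<omega> _ \<omega>'(3)]) (simp only: \<omega>'(2) that(2))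
      show "n \<le> T \<omega>" by (rule Suc.prems(4)[OF \<omega> that(2)])
    qed
    then have "rule_loss b T (Suc k) n h \<mu> = stop_loss b (h n) \<mu>"
      by (rule rule_loss_stop[OF Suc.prems(3,1)])
    then show ?thesis by simp
  next
    case False
    have "next_loss (opt_loss b k) \<mu> \<le> next_loss (\<lambda>x. rule_loss b T k (Suc n) (h(Suc n := x))) \<mu>"
    proof (intro next_loss_mono bounded_beliefD Suc.prems)
      fix x :: real
      have ge: "Suc n \<le> T \<omega>" if "\<omega> \<in> space (path_space N)" "restrict \<omega> {..Suc n} = h(Suc n := x)" for \<omega>
      proof (rule ccontr)
        assume "\<not> Suc n \<le> T \<omega>"
        then have "T \<omega> \<le> n" by simp
        with False that(1) restrict_fun_upd_Suc[OF Suc.prems(3) that(2)] show False by blast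
      qed
      have "opt_loss b k ((h(Suc n := x)) (Suc n)) (Psi Th q c x \<mu>) \<le>
          rule_loss b T k (Suc n) (h(Suc n := x)) (Psi Th q c x \<mu>)"
      proof (rule Suc.IH[OF bounded_belief_Psi[OF Suc.prems(1)] _ fun_upd_path_space[OF Suc.prems(3)] ge])
        show "Suc n + k = N" using Suc.prems(2) by simp
      qed
      then show "opt_loss b k x (Psi Th q c x \<mu>) \<le> rule_loss b T k (Suc n) (h(Suc n := x)) (Psi Th q c x \<mu>)"
        by simp
    qed
    then show ?thesis
      by (simp add: rule_loss_Suc[OF admissible_measurable[OF T] Suc.prems(2,3,1)] min.coboundedI2)
  qed
qed

text \<open>Accepting \<open>M\<close> is at least as good as waiting, so offers above
  \<open>M\<close> always reach the level.\<close>

lemma xstar_le_M: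
  assumes \<mu>: "bounded_belief Th \<mu>"
  shows "xstar Th lam q c U N n \<mu> \<le> M"
proof -
  have "U_avg U \<mu> (xstar Th lam q c U N n \<mu>) \<le> U_avg U \<mu> M"
    unfolding U_avg_xstar[OF \<mu>] dval_def by (rule continuation_le_U_avg[OF \<mu>])
  then show ?thesis using strict_mono_less_eq[OF U_avg_strict_mono[OF \<mu>]] by simp
qed

end

subsection \<open>The reservation level rule\<close>

locale house_selling_prior = house_selling +
  fixes Q0 :: "'a measure" and N :: nat
  assumes prob_space_Q0: "prob_space Q0" and sets_Q0: "sets Q0 = sets (param_space Th)"
begin

abbreviation "bel \<equiv> belief Th q c Q0"
abbreviation "xst n \<mu> \<equiv> xstar Th lam q c U N n \<mu>"
abbreviation "tau \<equiv> tau_star Th lam q c U Q0 N"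

lemma space_Q0: "space Q0 = Th"
  using sets_eq_imp_space_eq[OF sets_Q0] by (simp add: space_restrict_space)

lemma bounded_belief_bel: "bounded_belief Th (bel n h)"
proof (induction n)
  case 0
  interpret Q: prob_space Q0 by (rule prob_space_Q0)
  interpret R: prob_space "return cost_space 0" by (rule prob_space_return) (simp add: space_restrict_space)
  interpret P: pair_prob_space Q0 "return cost_space 0" ..
  have s [measurable_cong]: "sets (Q0 \<Otimes>\<^sub>M return cost_space 0) = sets (belief_space Th)"
    by (intro sets_pair_measure_cong sets_Q0 sets_return)
  have "AE z in Q0 \<Otimes>\<^sub>M return cost_space 0. \<bar>snd z\<bar> \<le> 0"
  proof (rule P.AE_pair_measure)
    show "{z \<in> space (Q0 \<Otimes>\<^sub>M return cost_space 0). \<bar>snd z\<bar> \<le> 0} \<in> sets (Q0 \<Otimes>\<^sub>M return cost_space 0)"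
      by measurable
    have "AE y in return cost_space 0. \<bar>y\<bar> \<le> (0::real)"
      by (subst AE_return) (auto simp: space_restrict_space intro!: measurable_restrict_space1)
    then show "AE x in Q0. AE y in return cost_space 0. \<bar>snd (x, y)\<bar> \<le> 0"
      by simp
  qed
  then show ?case
    using s P.prob_space_axioms by (auto intro: bounded_beliefI)
next
  case (Suc n)
  then show ?case by (simp add: bounded_belief_Psi)
qed

section \<open>Admissibility of the reservation level rule\<close>

lemma bel_measurable:
  "n \<le> m \<Longrightarrow> (\<lambda>\<omega>. bel n \<omega>) \<in> path_space m \<rightarrow>\<^sub>M beliefs"
proof (induction n)
  case 0
  show ?case
    using bounded_beliefD(3)[OF bounded_belief_bel[of 0]] by simp
next
  case (Suc n)
  then have [measurable]: "(\<lambda>\<omega>. bel n \<omega>) \<in> path_space m \<rightarrow>\<^sub>M beliefs" by simp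
  have [measurable]: "(\<lambda>\<omega>. \<omega> (Suc n)) \<in> borel_measurable (path_space m)"
    by (rule component_measurable_path)
  show ?case by simp
qed

text \<open>Measurability of the level itself is bypassed: up to \<open>M\<close> the event is a
  comparison of measurable losses, and above \<open>M\<close> it always occurs.\<close>

lemma stop_measurable:
  assumes n: "n \<le> m" "n < N"
  shows "Measurable.pred (path_space m) (\<lambda>\<omega>. xst n (bel n \<omega>) \<le> \<omega> n)"
proof -
  obtain k where k: "N - n = Suc k" using n by (metis Suc_diff_Suc)
  note bel = bel_measurable[OF n(1)]
  have [measurable]: "Measurable.pred (path_space m)
      (\<lambda>\<omega>. stop_loss M (\<omega> n) (bel n \<omega>) \<le> next_loss (opt_loss M k) (bel n \<omega>))"
    unfolding Measurable.pred_def
    by (intro borel_measurable_le stop_loss_measurable next_opt_loss_measurable component_measurable_path bel)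
  have [measurable]: "Measurable.pred (path_space m) (\<lambda>\<omega>. M < \<omega> n)"
    unfolding Measurable.pred_def by (intro borel_measurable_less component_measurable_path) simp
  have "xst n (bel n \<omega>) \<le> \<omega> n \<longleftrightarrow> M < \<omega> n \<or> stop_loss M (\<omega> n) (bel n \<omega>) \<le> next_loss (opt_loss M k) (bel n \<omega>)" for \<omega>
    using xstar_le_M[OF bounded_belief_bel[of n \<omega>], of N n]
      xstar_le_iff[where b = M, OF bounded_belief_bel[of n \<omega>] k order_refl, of "\<omega> n"]
    by (cases "\<omega> n \<le> M") auto
  moreover have "Measurable.pred (path_space m)
      (\<lambda>\<omega>. M < \<omega> n \<or> stop_loss M (\<omega> n) (bel n \<omega>) \<le> next_loss (opt_loss M k) (bel n \<omega>))"
    by measurable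
  ultimately show ?thesis by simp
qed

text \<open>For \<open>t < N\<close> the inserted cap \<open>N\<close> cannot witness
  \<open>tau \<omega> \<le> t\<close>.\<close>

lemma tau_le_iff: "t < N \<Longrightarrow> tau \<omega> \<le> t \<longleftrightarrow> (\<exists>n\<le>t. xst n (bel n \<omega>) \<le> \<omega> n)"
proof -
  assume t: "t < N"
  let ?S = "insert N {n. n < N \<and> xst n (bel n \<omega>) \<le> \<omega> n}"
  have "Inf ?S \<in> ?S" by (rule Inf_nat_def1) simp
  moreover have "Inf ?S \<le> n" if "n \<in> ?S" for n using that by (rule wellorder_Inf_le1)
  ultimately have S: "tau \<omega> \<in> ?S" "\<And>n. n \<in> ?S \<Longrightarrow> tau \<omega> \<le> n"
    unfolding tau_star_def by blast+
  show ?thesis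
  proof
    assume "tau \<omega> \<le> t"
    with S(1) t show "\<exists>n\<le>t. xst n (bel n \<omega>) \<le> \<omega> n" by auto
  next
    assume "\<exists>n\<le>t. xst n (bel n \<omega>) \<le> \<omega> n"
    then obtain n where "n \<le> t" "xst n (bel n \<omega>) \<le> \<omega> n" by blast
    with S(2)[of n] t show "tau \<omega> \<le> t" by auto
  qed
qed

lemma tau_le: "tau \<omega> \<le> N"
  unfolding tau_star_def by (rule wellorder_Inf_le1) simp

lemma tau_admissible: "tau \<in> admissible N"
  unfolding admissible_def
proof (intro CollectI conjI ballI tau_le stopping_timeI)
  fix t
  show "Measurable.pred (offer_filtration N t) (\<lambda>\<omega>. tau \<omega> \<le> t)"
  proof (cases "t < N")
    case False
    then have "tau \<omega> \<le> t" for \<omega> using tau_le[of \<omega>] by simp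
    then show ?thesis by simp
  next
    case True
    have 1: "Measurable.pred (path_space t) (\<lambda>\<omega>. \<exists>n\<in>{..t}. xst n (bel n \<omega>) \<le> \<omega> n)"
      using True by (intro pred_intros_finite stop_measurable) auto
    have 2: "(\<lambda>\<omega>. restrict \<omega> {..t}) \<in> offer_filtration N t \<rightarrow>\<^sub>M path_space t"
      unfolding offer_filtration_def by (rule measurable_vimage_algebra1) (auto simp: space_path_space)
    \<comment> \<open>Beliefs up to time \<open>t\<close> see only the prefix, so the event is a
      preimage under the restriction map that generates \<open>offer_filtration N t\<close>.\<close>
    have "bel n (restrict \<omega> {..t}) = bel n \<omega>" if "n \<le> t" for n \<omega>
      using that by (intro belief_cong) auto
    then have "(\<lambda>\<omega>. tau \<omega> \<le> t) = (\<lambda>\<omega>. \<exists>n\<in>{..t}. xst n (bel n (restrict \<omega> {..t})) \<le> restrict \<omega> {..t} n)"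
      using True by (auto simp: tau_le_iff fun_eq_iff)
    then show ?thesis using measurable_compose[OF 2 1] by simp
  qed
qed

text \<open>Equality instead of a lower bound requires the belief that the rule itself uses, and
  offers at most \<open>b\<close>, where \<open>xstar_le_iff\<close> applies. The support of the
  predictive law keeps the next offer in that range.\<close>

lemma rule_loss_tau:
  assumes b: "M \<le> b"
  shows "n + k = N \<Longrightarrow> h \<in> space (path_space n) \<Longrightarrow> h n \<le> b \<Longrightarrow>
    (\<And>\<omega>. \<omega> \<in> space (path_space N) \<Longrightarrow> restrict \<omega> {..n} = h \<Longrightarrow> n \<le> tau \<omega>) \<Longrightarrow>
    rule_loss b tau k n h (bel n h) = opt_loss b k (h n) (bel n h)"
proof (induction k arbitrary: n h)
  case 0
  have "tau \<omega> = n" if "\<omega> \<in> space (path_space (n + 0))" "restrict \<omega> {..n} = h" for \<omega>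
  proof (rule antisym)
    show "tau \<omega> \<le> n" using 0(1) tau_le[of \<omega>] by simp
    show "n \<le> tau \<omega>" using 0(4)[OF _ that(2)] that(1) 0(1) by simp
  qed
  then have "rule_loss b tau 0 n h (bel n h) = stop_loss b (h n) (bel n h)"
    by (rule rule_loss_stop[OF 0(2) bounded_belief_bel])
  then show ?case by simp
next
  case (Suc k)
  note bb = bounded_belief_bel[of n h]
  have n: "n < N" and k: "N - n = Suc k" using Suc.prems(1) by auto
  note iff = xstar_le_iff[OF bb k b Suc.prems(3)]
  \<comment> \<open>No earlier stop is possible on these paths, so the test at time \<open>n\<close>
    decides, and it sees the path only through \<open>h\<close>.\<close>
  have stop: "tau \<omega> = n \<longleftrightarrow> xst n (bel n h) \<le> h n"
    if \<omega>: "\<omega> \<in> space (path_space N)" "restrict \<omega> {..n} = h" for \<omega>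
  proof -
    have eq: "\<omega> i = h i" if "i \<le> n" for i using \<omega>(2) that by auto
    have bel: "bel n \<omega> = bel n h" using eq by (intro belief_cong) auto
    have ge: "n \<le> tau \<omega>" by (rule Suc.prems(4)[OF \<omega>])
    have "xst n (bel n \<omega>) \<le> \<omega> n" if "tau \<omega> = n"
    proof -
      have "tau \<omega> \<le> n" using that by simp
      then obtain m where m: "m \<le> n" "xst m (bel m \<omega>) \<le> \<omega> m"
        using tau_le_iff[OF n, of \<omega>] by blast
      then have "tau \<omega> \<le> m" using tau_le_iff[of m \<omega>] n by auto
      with ge m(1) have "m = n" by linarith
      with m(2) show ?thesis by simp
    qed
    moreover have "tau \<omega> = n" if "xst n (bel n \<omega>) \<le> \<omega> n"
      using that tau_le_iff[OF n, of \<omega>] ge by (intro antisym) auto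
    ultimately show ?thesis using bel eq by auto
  qed
  show ?case
  proof (cases "xst n (bel n h) \<le> h n")
    case True
    have "rule_loss b tau (Suc k) n h (bel n h) = stop_loss b (h n) (bel n h)"
    proof (rule rule_loss_stop[OF Suc.prems(2) bb])
      show "tau \<omega> = n" if "\<omega> \<in> space (path_space (n + Suc k))" "restrict \<omega> {..n} = h" for \<omega>
        using stop[OF _ that(2)] that(1) True unfolding Suc.prems(1) by simp
    qed
    then show ?thesis using True iff by simp
  next
    case False
    have "rule_loss b tau (Suc k) n h (bel n h) =
        next_loss (\<lambda>x. rule_loss b tau k (Suc n) (h(Suc n := x))) (bel n h)"
      by (rule rule_loss_Suc[OF admissible_measurable[OF tau_admissible] Suc.prems(1,2) bb])
    also have "\<dots> = next_loss (opt_loss b k) (bel n h)"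
    proof (intro next_loss_cong bounded_beliefD bb)
      fix x :: real assume x: "\<bar>x\<bar> \<le> M"
      let ?h = "h(Suc n := x)"
      have "bel n ?h = bel n h" by (intro belief_cong) auto
      then have bel: "bel (Suc n) ?h = Psi Th q c x (bel n h)" by simp
      have "rule_loss b tau k (Suc n) ?h (bel (Suc n) ?h) = opt_loss b k (?h (Suc n)) (bel (Suc n) ?h)"
      proof (rule Suc.IH)
        show "Suc n + k = N" using Suc.prems(1) by simp
        show "?h \<in> space (path_space (Suc n))" by (rule fun_upd_path_space[OF Suc.prems(2)])
        show "?h (Suc n) \<le> b" using x b by simp
        fix \<omega> assume \<omega>: "\<omega> \<in> space (path_space N)" "restrict \<omega> {..Suc n} = ?h"
        note r = restrict_fun_upd_Suc[OF Suc.prems(2) \<omega>(2)]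
        show "Suc n \<le> tau \<omega>"
          using stop[OF \<omega>(1) r] Suc.prems(4)[OF \<omega>(1) r] False by simp
      qed
      then show "rule_loss b tau k (Suc n) ?h (Psi Th q c x (bel n h)) = opt_loss b k x (Psi Th q c x (bel n h))"
        unfolding bel by simp
    qed
    also have "\<dots> = opt_loss b (Suc k) (h n) (bel n h)"
      using False iff by (simp add: min_def)
    finally show ?thesis .
  qed
qed

text \<open>Losses are integrated over paths for a fixed parameter, then over \<open>Q0\<close>; the
  point mass at cost 0 makes the latter an integral over the initial belief. The level
  \<open>max x M\<close> covers the initial and all later offers; \<open>\<omega>0\<close> is
  arbitrary because \<open>bel 0\<close> ignores the history.\<close>

lemma
  assumes T: "T \<in> admissible N"
  defines "b \<equiv> \<lambda>x. max x M"
  shows reward_le: "reward lam q c U Q0 N x T \<le> U (b x)"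
    and reward_loss: "ennreal (U (b x) - reward lam q c U Q0 N x T) =
      rule_loss (b x) T N 0 (\<lambda>i\<in>{..0}. x) (bel 0 \<omega>0)"
proof -
  interpret Q: prob_space Q0 by (rule prob_space_Q0)
  note T' = admissible_measurable[OF T]
  note [measurable] = stopped_measurable[OF T']
  note [measurable_cong] = sets_Q0
  let ?h0 = "\<lambda>i\<in>{..0}. x"
  define G where "G z = future N 0 (fst z) (path_loss (b x) T 0 z) ?h0" for z
  define R where "R \<theta> = (\<integral>\<omega>. U (\<omega> (T \<omega>) - c \<theta> * real (T \<omega>)) \<partial>offer_law lam q N x \<theta>)" for \<theta>
  \<comment> \<open>Worst case: the lowest possible offer after at most \<open>N\<close> costs
    \<open>cu\<close>. It does not depend on the parameter, which makes the outer integral finite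
    too.\<close>
  define L where "L = loss (b x) (min x (- M) - cu * real N)"
  have h0: "?h0 \<in> space (path_space 0)" unfolding space_path_space by (rule restrict_extensional)
  have "(\<lambda>w. future N 0 (fst (fst w)) (path_loss (b x) T 0 (fst w)) (snd w)) \<in>
      borel_measurable (belief_space Th \<Otimes>\<^sub>M path_space 0)"
    using path_loss_measurable[OF T'] by (intro future_measurable_pair) auto
  from measurable_compose[OF measurable_Pair2'[OF h0] this]
  have G [measurable]: "G \<in> borel_measurable (belief_space Th)" by (simp add: G_def[abs_def])
  have R: "R \<theta> \<le> U (b x)" "ennreal (U (b x) - R \<theta>) = G (\<theta>, 0)" "G (\<theta>, 0) \<le> L" if \<theta>: "\<theta> \<in> Th" for \<theta>
  proof -
    interpret P: prob_space "offer_law lam q N x \<theta>"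
      unfolding offer_law_def by (intro prob_space_PiM prob_space_offer_laws \<theta>)
    have s [measurable_cong]: "sets (offer_law lam q N x \<theta>) = sets (path_space N)"
      unfolding offer_law_def by (rule sets_PiM_offer_laws)
    have comp: "AE \<omega> in offer_law lam q N x \<theta>. \<bar>\<omega> i\<bar> \<le> M \<or> \<omega> i = x" if "i \<le> N" for i
      unfolding offer_law_def
    proof (rule AE_PiM_component[OF prob_space_offer_laws[OF \<theta>]])
      show "AE y in offer_laws x \<theta> i. \<bar>y\<bar> \<le> M \<or> y = x"
      proof (cases "i = 0")
        case True
        then show ?thesis by (simp add: AE_return)
      next
        case False
        have "AE y in offer_dist lam q \<theta>. \<bar>y\<bar> \<le> M \<or> y = x"
          unfolding offer_dist_def using \<theta> q_support[OF \<theta>] by (subst AE_density) auto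
        with False show ?thesis by simp
      qed
    qed (use that in auto)
    have "AE \<omega> in offer_law lam q N x \<theta>. \<forall>i\<in>{..N}. \<bar>\<omega> i\<bar> \<le> M \<or> \<omega> i = x"
      by (rule AE_finite_allI) (auto intro: comp)
    then have AE: "AE \<omega> in offer_law lam q N x \<theta>.
        \<omega> (T \<omega>) - c \<theta> * real (T \<omega>) \<le> b x \<and> min x (- M) - cu * real N \<le> \<omega> (T \<omega>) - c \<theta> * real (T \<omega>)"
      using AE_space
    proof eventually_elim
      case (elim \<omega>)
      then have TN: "T \<omega> \<le> N"
        using T sets_eq_imp_space_eq[OF s] by (auto simp: admissible_def)
      then have "\<bar>\<omega> (T \<omega>)\<bar> \<le> M \<or> \<omega> (T \<omega>) = x" using elim(1) by auto
      moreover have "0 \<le> c \<theta> * real (T \<omega>)" using c_bounds[OF \<theta>] by simp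
      moreover have "c \<theta> * real (T \<omega>) \<le> cu * real N"
        using c_bounds[OF \<theta>] TN by (intro mult_mono) auto
      ultimately show ?case by (auto simp: b_def)
    qed
    have F: "path_loss (b x) T 0 (\<theta>, 0) \<omega> = ennreal (U (b x) - U (\<omega> (T \<omega>) - c \<theta> * real (T \<omega>)))" for \<omega>
      by (simp add: path_loss_def loss_def)
    have m: "(\<lambda>\<omega>. U (\<omega> (T \<omega>) - c \<theta> * real (T \<omega>))) \<in> borel_measurable (offer_law lam q N x \<theta>)"
      by measurable
    then have "path_loss (b x) T 0 (\<theta>, 0) \<in> borel_measurable (path_space N)"
      unfolding F[abs_def] by measurable
    from nn_integral_offer_law[OF \<theta> this]
    have I: "(\<integral>\<^sup>+\<omega>. ennreal (U (b x) - U (\<omega> (T \<omega>) - c \<theta> * real (T \<omega>))) \<partial>offer_law lam q N x \<theta>) = G (\<theta>, 0)"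
      by (simp add: G_def F)
    have "G (\<theta>, 0) \<le> (\<integral>\<^sup>+\<omega>. L \<partial>offer_law lam q N x \<theta>)"
      unfolding I[symmetric] L_def loss_def
      using AE by (intro nn_integral_mono_AE, eventually_elim) (auto intro!: ennreal_leI U_mono)
    then show GL: "G (\<theta>, 0) \<le> L" by (simp add: P.emeasure_space_1)
    then have fin: "G (\<theta>, 0) < \<infinity>" by (rule le_less_trans) (simp add: L_def loss_def)
    have le: "AE \<omega> in offer_law lam q N x \<theta>. U (\<omega> (T \<omega>) - c \<theta> * real (T \<omega>)) \<le> U (b x)"
      using AE by eventually_elim (auto intro: U_mono)
    from P.integral_eq_const_minus_nn_integral[OF m le I fin]
    show "R \<theta> \<le> U (b x)" "ennreal (U (b x) - R \<theta>) = G (\<theta>, 0)" by (auto simp: R_def)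
  qed
  have G0 [measurable]: "(\<lambda>\<theta>. G (\<theta>, 0)) \<in> borel_measurable Q0"
    by (rule measurable_compose[OF _ G]) (auto simp: space_restrict_space)
  \<comment> \<open>Measurability of the expected utility in the parameter is read off from the
    iterated integral \<open>G\<close>.\<close>
  have "(\<lambda>\<theta>. U (b x) - enn2real (G (\<theta>, 0))) \<in> borel_measurable Q0" by measurable
  also have "?this \<longleftrightarrow> R \<in> borel_measurable Q0"
  proof (rule measurable_cong)
    fix \<theta> assume "\<theta> \<in> space Q0"
    then have "\<theta> \<in> Th" by (simp add: space_Q0)
    from R(1)[OF this] R(2)[OF this, symmetric] show "U (b x) - enn2real (G (\<theta>, 0)) = R \<theta>" by simp
  qed
  finally have Rm: "R \<in> borel_measurable Q0" .
  have le: "AE \<theta> in Q0. R \<theta> \<le> U (b x)" using R(1) by (intro AE_I2) (simp add: space_Q0)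
  have I: "(\<integral>\<^sup>+\<theta>. ennreal (U (b x) - R \<theta>) \<partial>Q0) = (\<integral>\<^sup>+\<theta>. G (\<theta>, 0) \<partial>Q0)"
    using R(2) by (intro nn_integral_cong) (simp add: space_Q0)
  have "(\<integral>\<^sup>+\<theta>. G (\<theta>, 0) \<partial>Q0) \<le> (\<integral>\<^sup>+\<theta>. L \<partial>Q0)"
    using R(3) by (intro nn_integral_mono) (simp add: space_Q0)
  also have "\<dots> < \<infinity>" by (simp add: Q.emeasure_space_1 L_def loss_def)
  finally have fin: "(\<integral>\<^sup>+\<theta>. G (\<theta>, 0) \<partial>Q0) < \<infinity>" .
  interpret Z: prob_space "return cost_space 0" by (rule prob_space_return) (simp add: space_restrict_space)
  have s0: "sets (Q0 \<Otimes>\<^sub>M return cost_space 0) = sets (belief_space Th)"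
    by (intro sets_pair_measure_cong sets_Q0 sets_return)
  have "G \<in> borel_measurable (Q0 \<Otimes>\<^sub>M return cost_space 0)"
    using G by (simp add: measurable_cong_sets[OF s0 refl])
  then have "(\<integral>\<^sup>+z. G z \<partial>(Q0 \<Otimes>\<^sub>M return cost_space 0)) = (\<integral>\<^sup>+\<theta>. \<integral>\<^sup>+s. G (\<theta>, s) \<partial>return cost_space 0 \<partial>Q0)"
    by (rule Z.nn_integral_fst[symmetric])
  also have "\<dots> = (\<integral>\<^sup>+\<theta>. G (\<theta>, 0) \<partial>Q0)"
  proof (intro nn_integral_cong nn_integral_return)
    fix \<theta> assume "\<theta> \<in> space Q0"
    then show "(\<lambda>s. G (\<theta>, s)) \<in> borel_measurable cost_space"
      by (intro measurable_compose[OF measurable_Pair1' G]) (simp add: space_Q0 space_restrict_space)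
  qed (simp add: space_restrict_space)
  finally have rl: "(\<integral>\<^sup>+\<theta>. G (\<theta>, 0) \<partial>Q0) = rule_loss (b x) T N 0 ?h0 (bel 0 \<omega>0)"
    by (simp add: rule_loss_def G_def)
  have rew: "reward lam q c U Q0 N x T = integral\<^sup>L Q0 R" by (simp add: reward_def R_def[abs_def])
  from Q.integral_eq_const_minus_nn_integral[OF Rm le I fin]
  show "reward lam q c U Q0 N x T \<le> U (b x)"
    "ennreal (U (b x) - reward lam q c U Q0 N x T) = rule_loss (b x) T N 0 ?h0 (bel 0 \<omega>0)"
    unfolding rew rl by auto
qed

text \<open>The lower bound for \<open>T\<close> and the equality for the rule meet at the same
  \<open>opt_loss\<close> of the initial history.\<close>

lemma tau_optimal:
  assumes T: "T \<in> admissible N"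
  shows "reward lam q c U Q0 N x T \<le> reward lam q c U Q0 N x tau"
proof -
  let ?h0 = "\<lambda>i\<in>{..0::nat}. x" and ?b = "max x M"
  have h0: "?h0 \<in> space (path_space 0)" unfolding space_path_space by (rule restrict_extensional)
  have "rule_loss ?b tau N 0 ?h0 (bel 0 ?h0) = opt_loss ?b N (?h0 0) (bel 0 ?h0)"
    by (rule rule_loss_tau) (use h0 in auto)
  also have "\<dots> \<le> rule_loss ?b T N 0 ?h0 (bel 0 ?h0)"
    by (rule opt_loss_le_rule_loss[OF T bounded_belief_bel _ h0]) auto
  finally have "ennreal (U ?b - reward lam q c U Q0 N x tau) \<le> ennreal (U ?b - reward lam q c U Q0 N x T)"
    by (simp only: reward_loss[OF tau_admissible, of x ?h0] reward_loss[OF T, of x ?h0])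
  then show ?thesis
    using reward_le[OF T, of x] by (simp add: ennreal_le_iff)
qed

end

theorem theorem5p1:
  fixes Th :: "'a::polish_space set"
    and Q0 :: "'a measure"
    and lam :: "real measure"
    and q :: "real \<Rightarrow> 'a \<Rightarrow> real"
    and c :: "'a \<Rightarrow> real"
    and cl cu :: real
    and U :: "real \<Rightarrow> real"
    and N :: nat
  assumes "Th \<in> sets borel"
    and "prob_space Q0" and "sets Q0 = sets (param_space Th)"
    and "sigma_finite_measure lam" and "sets lam = sets borel"
    and "\<And>x \<theta>. \<theta> \<in> Th \<Longrightarrow> 0 \<le> q x \<theta>"
    and "\<And>\<theta>. \<theta> \<in> Th \<Longrightarrow> prob_space (offer_dist lam q \<theta>)"
    and "continuous_on (UNIV \<times> Th) (\<lambda>(x, \<theta>). q x \<theta>)"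
    and "\<exists>K. compact K \<and> (\<forall>\<theta>\<in>Th. \<forall>x. q x \<theta> \<noteq> 0 \<longrightarrow> x \<in> K)"
    and "continuous_on Th c"
    and "0 < cl" and "cl < cu" and "\<And>\<theta>. \<theta> \<in> Th \<Longrightarrow> cl \<le> c \<theta> \<and> c \<theta> \<le> cu"
    and "strict_mono U" and "concave_on UNIV U"
    and "(SUP \<theta>\<in>Th. \<integral>\<^sup>+ x. ennreal (max x 0) \<partial>offer_dist lam q \<theta>) < \<infinity>"
    and "1 \<le> N"
  shows "(tau_star Th lam q c U Q0 N \<in> admissible N \<and>
          (\<forall>x. ereal (reward lam q c U Q0 N x (tau_star Th lam q c U Q0 N)) = Jval lam q c U Q0 N x))
     \<and> (\<forall>\<mu>. bounded_belief Th \<mu> \<longrightarrow>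
          xstar Th lam q c U N (N - 1) \<mu> =
            inv (U_avg U \<mu>)
              (\<integral>x. (\<integral>s. U (x + s) \<partial>marg_cost (Psi Th q c x \<mu>)) \<partial>QX lam q (marg_param Th \<mu>)))
     \<and> (\<forall>n \<mu>. n + 2 \<le> N \<and> bounded_belief Th \<mu> \<longrightarrow>
          xstar Th lam q c U N n \<mu> =
            inv (U_avg U \<mu>)
              (\<integral>x. U_avg U (Psi Th q c x \<mu>) (max x (xstar Th lam q c U N (n + 1) (Psi Th q c x \<mu>)))
                 \<partial>QX lam q (marg_param Th \<mu>)))"
proof -
  obtain K where K: "compact K" "\<And>\<theta> x. \<theta> \<in> Th \<Longrightarrow> q x \<theta> \<noteq> 0 \<Longrightarrow> x \<in> K"
    using assms(9) by blast
  obtain M where M: "\<And>x. x \<in> K \<Longrightarrow> \<bar>x\<bar> \<le> M"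
    using compact_imp_bounded[OF K(1)] by (auto simp: bounded_iff)
  have c: "0 \<le> c \<theta> \<and> c \<theta> \<le> cu" if "\<theta> \<in> Th" for \<theta>
    using assms(11) assms(13)[OF that] by simp
  interpret house_selling_prior Th lam q c U M cu Q0 N
    by (intro house_selling_prior.intro house_selling.intro house_selling_prior_axioms.intro
        assms(2-8,10,14,15) c M K(2))
  have "ereal (reward lam q c U Q0 N x tau) = Jval lam q c U Q0 N x" for x
    unfolding Jval_def
    by (intro antisym SUP_upper SUP_least tau_admissible) (simp add: tau_optimal)
  \<comment> \<open>Since \<open>N - (N - 1) = 1\<close>, the integrand is \<open>V 0\<close>, the
    averaged utility, and the formula is an unfolding.\<close>
  moreover have "xst (N - 1) \<mu> = inv (U_avg U \<mu>)
      (\<integral>x. (\<integral>s. U (x + s) \<partial>marg_cost (Psi Th q c x \<mu>)) \<partial>QX lam q (marg_param Th \<mu>))" for \<mu>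
    using assms(17) by (simp add: xstar_def dval_def continuation_def U_avg_def)
  moreover have "xst n \<mu> = inv (U_avg U \<mu>)
      (\<integral>x. U_avg U (Psi Th q c x \<mu>) (max x (xst (n + 1) (Psi Th q c x \<mu>))) \<partial>QX lam q (marg_param Th \<mu>))"
    if "n + 2 \<le> N" "bounded_belief Th \<mu>" for n \<mu>
    unfolding xstar_def[of Th lam q c U N n \<mu>] xstar_recursion[OF that(2,1)] ..
  ultimately show ?thesis using tau_admissible by blast
qed

end
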